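(* Let $d\ge 2$ be an integer, let $i\in\{1,\dots,d\}$, and let $c\in\mathbb{R}\setminus\mathbb{Q}$ be a number with the bounded ratio property. Consider the hyperplane $\mathcal{H}=\{\boldsymbol{x}\in\mathbb{R}^d: x_i=c\}$ (the perpendicular translate of a coordinate hyperplane by $c$). If $d\ge3$, then $\mathcal{H}$ is of Khintchine type. Moreover, $\mathcal{H}$ is of Khintchine type for convergence even when $d=2$.
   Context: An approximating function is a non-increasing function $\psi:\mathbb{N}\to[0,\infty)$. A point $\boldsymbol{x}\in\mathbb{R}^d$ is $\psi$-approximable if $\|q\boldsymbol{x}-\boldsymbol{p}\|_\infty<\psi(q)$ holds for infinitely many $(\boldsymbol{p},q)\in\mathbb{Z}^d\times\mathbb{N}$. A manifold $\mathcal{M}\subset\mathbb{R}^d$ is of Khintchine type for divergence if for every approximating function $\psi$ with $\sum_{q}\psi(q)^d=\infty$, almost every point of $\mathcal{M}$ is $\psi$-approximable; it is of Khintchine type for convergence if for every approximating function $\psi$ with $\sum_q\psi(q)^d<\infty$, almost no point of $\mathcal{M}$ is $\psi$-approximable; it is of Khintchine type if it is both. For a hyperplane, "almost every/no" refers to $(d-1)$-dimensional Lebesgue measure on it. For irrational $x=[a_0;a_1,a_2,\dots]$ (simple continued fraction), the continuants are $q_{-1}=0$, $q_0=1$, $q_k=a_kq_{k-1}+q_{k-2}$. Given an integer $R\ge1$, put $k_0=-1$ and let $k_1<k_2<\cdots$ be the (finite or infinite) increasing list of all indices $k\ge0$ with $a_{k+1}>R$. For $m\ge0$ define the block $B_{m+1}=[\,q_{k_m+1}-Rq_{k_m},\;q_{k_{m+1}}\,]\cap\mathbb{N}$;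 if the list ends with $k_t$, then $B_{t+1}=[\,q_{k_t+1}-Rq_{k_t},\infty)\cap\mathbb{N}$ is the last block. Put $B_{m+1}-B_m:=\min B_{m+1}-\max B_m=q_{k_m+1}-(R+1)q_{k_m}$, and let $\Sigma_{\omega_m}$ be the sum of all elements of the blocks $B_1,\dots,B_m$ (summed block by block). The number $x$ has the bounded ratio property if there is $R\ge1$ such that $\sum_{m\ge1}\frac{B_{m+1}-B_m}{\Sigma_{\omega_m}}<\infty$. If the list $\{k_m\}$ is finite, the sum is finite and the condition is regarded as satisfied. *)

theory Defs
  imports "HOL-Analysis.Analysis" "HOL-Library.Infinite_Set"
begin

section \<open>Approximation and Khintchine type\<close>

text \<open>Throughout, the paper's natural numbers start at 1, so values at 0 are never used.\<close>

definition approximating_function :: "(nat \<Rightarrow> real) \<Rightarrow> bool" where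
  "approximating_function \<psi> \<longleftrightarrow>
     (\<forall>q\<ge>1. 0 \<le> \<psi> q) \<and> (\<forall>q\<ge>1. \<forall>r\<ge>q. \<psi> r \<le> \<psi> q)"

definition psi_approximable :: "(nat \<Rightarrow> real) \<Rightarrow> real ^ 'n::finite \<Rightarrow> bool" where
  "psi_approximable \<psi> x \<longleftrightarrow>
     infinite {(p :: int ^ 'n, q :: nat).
       q \<ge> 1 \<and> infnorm (real q *\<^sub>R x - (\<chi> j. real_of_int (p $ j))) < \<psi> q}"

text \<open>A manifold enters these definitions as its natural measure \<open>\<mu>\<close>, whose space is the manifold.
  The Borel measure gives the same null sets as its completion, because \<open>AE\<close> only asks
  that the exceptional set be contained in a measurable null set.\<close>

definition khintchine_type_divergence :: "(real ^ 'n::finite) measure \<Rightarrow> bool" where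
  "khintchine_type_divergence \<mu> \<longleftrightarrow>
     (\<forall>\<psi>. approximating_function \<psi> \<and> \<not> summable (\<lambda>q. \<psi> (Suc q) ^ CARD('n)) \<longrightarrow>
        (AE x in \<mu>. psi_approximable \<psi> x))"

definition khintchine_type_convergence :: "(real ^ 'n::finite) measure \<Rightarrow> bool" where
  "khintchine_type_convergence \<mu> \<longleftrightarrow>
     (\<forall>\<psi>. approximating_function \<psi> \<and> summable (\<lambda>q. \<psi> (Suc q) ^ CARD('n)) \<longrightarrow>
        (AE x in \<mu>. \<not> psi_approximable \<psi> x))"

definition khintchine_type :: "(real ^ 'n::finite) measure \<Rightarrow> bool" where
  "khintchine_type \<mu> \<longleftrightarrow> khintchine_type_divergence \<mu> \<and> khintchine_type_convergence \<mu>"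

section \<open>Translates of coordinate hyperplanes\<close>

definition coord_hyperplane :: "'n::finite \<Rightarrow> real \<Rightarrow> (real ^ 'n) set" where
  "coord_hyperplane i c = {x. x $ i = c}"

definition hyperplane_embed :: "'n::finite \<Rightarrow> real \<Rightarrow> ('n \<Rightarrow> real) \<Rightarrow> real ^ 'n" where
  "hyperplane_embed i c y = (\<chi> j. if j = i then c else y j)"

text \<open>The Lebesgue measure of dimension \<open>CARD('n) - 1\<close> on the hyperplane: the product
  Lebesgue measure in the coordinates other than \<open>i\<close>, transported by an isometry.\<close>

definition hyperplane_lborel :: "'n::finite \<Rightarrow> real \<Rightarrow> (real ^ 'n) measure" where
  "hyperplane_lborel i c =
     distr (\<Pi>\<^sub>M j\<in>UNIV - {i}. lborel) (restrict_space borel (coord_hyperplane i c))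
       (hyperplane_embed i c)"

lemma hyperplane_embed_measurable [measurable]:
  "hyperplane_embed i c \<in>
     measurable (\<Pi>\<^sub>M j\<in>UNIV - {i}. lborel) (restrict_space borel (coord_hyperplane i c))"
proof (rule measurable_restrict_space2)
  show "hyperplane_embed i c \<in>
      space (\<Pi>\<^sub>M j\<in>UNIV - {i}. lborel) \<rightarrow> coord_hyperplane i c"
    by (simp add: hyperplane_embed_def coord_hyperplane_def)
  show "hyperplane_embed i c \<in> borel_measurable (\<Pi>\<^sub>M j\<in>UNIV - {i}. lborel)"
  proof (subst borel_measurable_euclidean_space, intro ballI)
    fix b :: "real ^ 'a" assume "b \<in> Basis"
    then obtain j where b: "b = axis j 1"
      by (auto simp: Basis_vec_def)
    have "(\<lambda>y. if j = i then c else y j)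
        \<in> borel_measurable (\<Pi>\<^sub>M j\<in>UNIV - {i}. lborel)"
    proof (cases "j = i")
      case False
      then have "(\<lambda>y. y j) \<in> measurable (\<Pi>\<^sub>M j\<in>UNIV - {i}. lborel) (lborel :: real measure)"
        by (intro measurable_component_singleton) auto
      with False show ?thesis by simp
    qed simp
    then show "(\<lambda>y. hyperplane_embed i c y \<bullet> b)
        \<in> borel_measurable (\<Pi>\<^sub>M j\<in>UNIV - {i}. lborel)"
      by (simp add: b hyperplane_embed_def inner_axis)
  qed
qed

lemma space_hyperplane_lborel [simp]:
  "space (hyperplane_lborel i c) = coord_hyperplane i c"
  by (simp add: hyperplane_lborel_def space_restrict_space)

section \<open>Continued fractions and the bounded ratio property\<close>

primrec cf_complete_quotient :: "real \<Rightarrow> nat \<Rightarrow> real" where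
  "cf_complete_quotient x 0 = x"
| "cf_complete_quotient x (Suc n) = 1 / frac (cf_complete_quotient x n)"

definition cf_partial_quotient :: "real \<Rightarrow> nat \<Rightarrow> int" where
  "cf_partial_quotient x n = \<lfloor>cf_complete_quotient x n\<rfloor>"

text \<open>Continuants are shifted by one to start at index 0: \<open>cf_continuant x n\<close> is
  \<open>q\<^bsub>n-1\<^esub>\<close>.\<close>

fun cf_continuant :: "real \<Rightarrow> nat \<Rightarrow> int" where
  "cf_continuant x 0 = 0"
| "cf_continuant x (Suc 0) = 1"
| "cf_continuant x (Suc (Suc n)) =
     cf_partial_quotient x (Suc n) * cf_continuant x (Suc n) + cf_continuant x n"

text \<open>The indices \<open>k\<^sub>m\<close> are shifted in the same way. The set below
  consists of the numbers \<open>k + 1\<close> with \<open>k \<ge> 0\<close> and partial quotient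
  \<open>a\<^bsub>k+1\<^esub> > R\<close>, and \<open>cf_index R x m\<close> is \<open>k\<^sub>m + 1\<close>;
  in particular \<open>cf_index R x 0 = 0\<close> encodes \<open>k\<^sub>0 = -1\<close>.\<close>

definition cf_large :: "nat \<Rightarrow> real \<Rightarrow> nat set" where
  "cf_large R x = {n. n \<ge> 1 \<and> cf_partial_quotient x n > int R}"

primrec cf_index :: "nat \<Rightarrow> real \<Rightarrow> nat \<Rightarrow> nat" where
  "cf_index R x 0 = 0"
| "cf_index R x (Suc m) = enumerate (cf_large R x) m"

text \<open>\<open>cf_block R x m\<close> is \<open>B\<^sub>m\<close> for \<open>m \<ge> 1\<close>. If there are exactly
  \<open>t\<close> large partial quotients, then \<open>B\<^bsub>t+1\<^esub>\<close> is unbounded above, and the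
  values for \<open>m > t + 1\<close> have no meaning.\<close>

primrec cf_block :: "nat \<Rightarrow> real \<Rightarrow> nat \<Rightarrow> nat set" where
  "cf_block R x 0 = {}"
| "cf_block R x (Suc m) =
     {n. cf_continuant x (Suc (cf_index R x m)) - int R * cf_continuant x (cf_index R x m) \<le> int n \<and>
         (infinite (cf_large R x) \<or> m < card (cf_large R x) \<longrightarrow>
            int n \<le> cf_continuant x (cf_index R x (Suc m)))}"

text \<open>The gap \<open>B\<^bsub>m+1\<^esub> - B\<^sub>m\<close>, i.e. the lower end of \<open>B\<^bsub>m+1\<^esub>\<close>
  minus the upper end \<open>q\<^bsub>k\<^sub>m\<^esub>\<close> of \<open>B\<^sub>m\<close>.\<close>

definition cf_gap :: "nat \<Rightarrow> real \<Rightarrow> nat \<Rightarrow> int" where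
  "cf_gap R x m = cf_continuant x (Suc (cf_index R x m))
     - (int R + 1) * cf_continuant x (cf_index R x m)"

text \<open>Block by block, hence with multiplicity: the number 1 lies in both \<open>B\<^sub>1\<close> and
  \<open>B\<^sub>2\<close> when \<open>a\<^sub>1 = R + 1\<close>.\<close>

definition cf_block_sum :: "nat \<Rightarrow> real \<Rightarrow> nat \<Rightarrow> nat" where
  "cf_block_sum R x m = (\<Sum>j=1..m. \<Sum>(cf_block R x j))"

definition bounded_ratio :: "real \<Rightarrow> bool" where
  "bounded_ratio x \<longleftrightarrow>
     (\<exists>R\<ge>1. finite (cf_large R x) \<or>
        summable (\<lambda>m. real_of_int (cf_gap R x (Suc m)) / real (cf_block_sum R x (Suc m))))"

end

(* Fix the coordinate x_i = c. The point is psi-approximable iff the other coordinates are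
   approximable with radii psi q restricted to those q for which q c is within psi q of an integer.

   Convergence: let q_k be the continuants of c. In a window of length about q_k / 2 the multiples
   of c are 1/(2 q_k)-separated modulo 1, so at most 4 psi q_k + 2 of them come within psi of an
   integer. Comparing each window in (q_k, q_(k+1)] with the preceding one bounds the restricted
   sum of psi^(d-1) by the sum of psi^d plus the sum of q_(k+1) / q_k^2. The latter converges by
   the bounded ratio property, because the sum of the first m blocks is at most 3 q_(k_m)^2.
   Then Borel-Cantelli applies.

   Divergence: Dirichlet's pigeonhole argument and Abel summation show that the restricted sum of
   psi^(d-1) diverges. For d - 1 >= 2, Gallagher's theorem holds without monotonicity: cubes around
   reduced rational vectors are pairwise quasi-independent, and a zero-one law upgrades positive
   measure to full measure. *)

theory Submission
  imports Defs
begin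

section \<open>Continued fractions\<close>

text \<open>Fixing x_i = c leaves a radius supported on an irregular set of q, so monotonicity is
  lost where metric theorems usually spend it; it has to be spent on the sums instead. For
  convergence let \<delta> be the value of \<psi> at the boundary of two adjacent windows. If
  \<delta> q_k >= 1, at most 6 \<delta> q_k points of the window are near, which supplies the
  missing factor \<delta>. Otherwise the window costs at most 6 / q_k, and the number of windows
  turns this into q_(k+1) / q_k^2. For small partial quotients this ratio is O(1 / q_k), summable by
  exponential growth; for large ones the part of q_(k+1) beyond (R + 1) q_k is exactly a gap of the
  bounded ratio property. For divergence, two free coordinates enter through the count of reduced
  vectors: for n >= 2 the sum of 1 / e^n over e >= 2 is below 1, so a fixed proportion of the
  numerators is reduced for every q, whereas Euler's totient divided by q has no positive lower
  bound. The metric theorems live on R^d with coordinate i ignored; Fubini transfers them to the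
  hyperplane.\<close>

lemma cf_complete_quotient_irrational:
  assumes "x \<notin> \<rat>"
  shows "cf_complete_quotient x n \<notin> \<rat>"
proof (induction n)
  case (Suc n)
  have "frac (cf_complete_quotient x n) \<notin> \<rat>"
  proof
    assume "frac (cf_complete_quotient x n) \<in> \<rat>"
    then have "frac (cf_complete_quotient x n) + real_of_int \<lfloor>cf_complete_quotient x n\<rfloor> \<in> \<rat>"
      by (rule Rats_add) simp
    then show False using Suc by (simp add: frac_def)
  qed
  then show ?case using Rats_inverse[of "cf_complete_quotient x (Suc n)"] by (auto simp: divide_inverse)
qed (use assms in simp)

lemma cf_complete_quotient_gt_1:
  assumes "x \<notin> \<rat>"
  shows "cf_complete_quotient x (Suc n) > 1"
proof -
  have "cf_complete_quotient x n \<notin> \<int>"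
    using cf_complete_quotient_irrational[OF assms, of n] Ints_subset_Rats by blast
  then have "frac (cf_complete_quotient x n) > 0" by (simp add: frac_gt_0_iff)
  moreover have "frac (cf_complete_quotient x n) < 1" by (rule frac_lt_1)
  ultimately show ?thesis by simp
qed

lemma cf_partial_quotient_ge_1:
  assumes "x \<notin> \<rat>"
  shows "cf_partial_quotient x (Suc n) \<ge> 1"
  using cf_complete_quotient_gt_1[OF assms, of n] unfolding cf_partial_quotient_def by linarith

section \<open>Growth of the continuants\<close>

lemma cf_continuant_nonneg:
  assumes "x \<notin> \<rat>"
  shows "cf_continuant x n \<ge> 0 \<and> cf_continuant x (Suc n) \<ge> 1"
proof (induction n)
  case (Suc n)
  then have "cf_partial_quotient x (Suc n) * cf_continuant x (Suc n) \<ge> 1 * 1"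
    using cf_partial_quotient_ge_1[OF assms, of n] by (intro mult_mono) auto
  with Suc show ?case by simp
qed simp

lemma cf_continuant_add_le:
  assumes "x \<notin> \<rat>"
  shows "cf_continuant x (Suc n) + cf_continuant x n \<le> cf_continuant x (Suc (Suc n))"
  using mult_right_mono[OF cf_partial_quotient_ge_1[OF assms, of n], of "cf_continuant x (Suc n)"]
    cf_continuant_nonneg[OF assms, of n] by simp

lemma cf_continuant_mono:
  assumes "x \<notin> \<rat>" "m \<le> n"
  shows "cf_continuant x m \<le> cf_continuant x n"
proof (rule lift_Suc_mono_le[OF _ assms(2)])
  fix n show "cf_continuant x n \<le> cf_continuant x (Suc n)"
  proof (cases n)
    case (Suc k)
    show ?thesis
      unfolding Suc
      using cf_continuant_add_le[OF assms(1), of k] cf_continuant_nonneg[OF assms(1), of k] by linarith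
  qed simp
qed

text \<open>Each continuant is at least the sum of the two before it, so any base t with t^2 <= t +
  1 works; 3/2 is a rational choice below the golden ratio. The factor 3/2 on the right lets the
  case n = 1 start from a continuant that may equal 1.\<close>

lemma cf_continuant_exp_growth:
  assumes "x \<notin> \<rat>"
  shows "(3/2) ^ n \<le> 3/2 * real_of_int (cf_continuant x (Suc n))"
proof (induction n rule: induct_nat_012)
  case (ge2 n)
  have "cf_continuant x (Suc (Suc n)) + cf_continuant x (Suc n) \<le> cf_continuant x (Suc (Suc (Suc n)))"
    by (rule cf_continuant_add_le[OF assms])
  then have *: "real_of_int (cf_continuant x (Suc (Suc n))) + real_of_int (cf_continuant x (Suc n))
      \<le> real_of_int (cf_continuant x (Suc (Suc (Suc n))))"
    by linarith
  have "(3/2::real) ^ Suc (Suc n) \<le> (3/2) ^ n + (3/2) ^ Suc n"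
    by simp
  with ge2 * show ?case by linarith
qed (use cf_continuant_nonneg[OF assms, of 1] in auto)

lemma summable_inverse_cf_continuant:
  assumes "x \<notin> \<rat>"
  shows "summable (\<lambda>n. 1 / real_of_int (cf_continuant x (Suc n)))"
proof (rule summable_comparison_test'[where N = 0])
  show "summable (\<lambda>n. 3/2 * (2/3::real) ^ n)"
    by (intro summable_mult summable_geometric) simp
  fix n
  have "real_of_int (cf_continuant x (Suc n)) \<ge> 1"
    using cf_continuant_nonneg[OF assms, of n] by simp
  then show "norm (1 / real_of_int (cf_continuant x (Suc n))) \<le> 3/2 * (2/3) ^ n"
    using cf_continuant_exp_growth[OF assms, of n] by (simp add: field_simps)
qed

section \<open>Errors and coprimality of the convergents\<close>

fun cf_numerator :: "real \<Rightarrow> nat \<Rightarrow> int" where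
  "cf_numerator x 0 = 1"
| "cf_numerator x (Suc 0) = cf_partial_quotient x 0"
| "cf_numerator x (Suc (Suc n)) =
     cf_partial_quotient x (Suc n) * cf_numerator x (Suc n) + cf_numerator x n"

lemma cf_determinant:
  "cf_continuant x (Suc n) * cf_numerator x n - cf_continuant x n * cf_numerator x (Suc n) = (- 1) ^ n"
proof (induction n)
  case (Suc n)
  then show ?case by (simp add: algebra_simps)
qed simp

definition cf_error :: "real \<Rightarrow> nat \<Rightarrow> real" where
  "cf_error x n = real_of_int (cf_continuant x n) * x - real_of_int (cf_numerator x n)"

text \<open>Numerators and continuants obey the same recurrence, hence so do the errors, and their
  ratio follows the map x -> 1 / frac x that generates the complete quotients. The errors start with
  -1 at index 0 (from p_(-1) = 1, q_(-1) = 0) and frac x at index 1.\<close>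

lemma cf_error_Suc:
  assumes "x \<notin> \<rat>"
  shows "cf_error x n = - cf_complete_quotient x (Suc n) * cf_error x (Suc n)"
proof (induction n)
  case 0
  have "frac x \<noteq> 0" using assms Ints_subset_Rats by (auto simp: frac_eq_0_iff)
  then show ?case
    by (simp add: cf_error_def cf_partial_quotient_def frac_def)
next
  case (Suc n)
  let ?X = "cf_complete_quotient x (Suc n)"
  have "cf_error x (Suc (Suc n)) =
      real_of_int (cf_partial_quotient x (Suc n)) * cf_error x (Suc n) + cf_error x n"
    by (simp add: cf_error_def algebra_simps)
  also have "\<dots> = - frac ?X * cf_error x (Suc n)"
    by (subst Suc) (simp add: cf_partial_quotient_def frac_def algebra_simps)
  finally have "cf_error x (Suc (Suc n)) = - frac ?X * cf_error x (Suc n)" .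
  moreover have "frac ?X \<noteq> 0"
    using cf_complete_quotient_irrational[OF assms, of "Suc n"] Ints_subset_Rats
    by (auto simp: frac_eq_0_iff simp del: cf_complete_quotient.simps)
  ultimately show ?case
    by (subst cf_complete_quotient.simps(2)) simp
qed

text \<open>The determinant identity serves twice. It makes p and q coprime, and written with the
  errors of two consecutive convergents it becomes |E| (q X + q') = 1 for a complete quotient X > 1,
  whence |E| q <= 1.\<close>

lemma cf_convergent:
  fixes x :: real and n :: nat
  assumes "x \<notin> \<rat>"
  defines "q \<equiv> cf_continuant x (Suc n)"
  obtains p where "coprime p q" "\<bar>real_of_int q * x - real_of_int p\<bar> \<le> 1 / real_of_int q"
proof
  let ?p = "cf_numerator x (Suc n)"
  have "q * cf_numerator x n - ?p * cf_continuant x n = (- 1) ^ n"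
    using cf_determinant[of x n] unfolding q_def by (simp add: mult.commute)
  then have "is_unit (q * cf_numerator x n - ?p * cf_continuant x n)"
    by simp
  moreover have "gcd ?p q dvd q * cf_numerator x n - ?p * cf_continuant x n"
    by (intro dvd_diff dvd_mult2) auto
  ultimately show "coprime ?p q"
    by (metis coprime_iff_gcd_eq_1 dvd_trans is_unit_gcd_iff)
  define E where "E = cf_error x (Suc n)"
  have q: "q \<ge> 1" and q': "cf_continuant x n \<ge> 0"
    using cf_continuant_nonneg[OF assms(1), of n] by (auto simp: q_def)
  define X where "X = cf_complete_quotient x (Suc n)"
  have X: "X > 1"
    unfolding X_def by (rule cf_complete_quotient_gt_1[OF assms(1)])
  \<comment> \<open>The terms with x cancel, which leaves the determinant up to sign.\<close>
  have "real_of_int q * cf_error x n - real_of_int (cf_continuant x n) * E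
      = - real_of_int (q * cf_numerator x n - cf_continuant x n * cf_numerator x (Suc n))"
    unfolding E_def cf_error_def q_def by (simp only: of_int_diff of_int_mult) algebra
  also have "\<dots> = - real_of_int ((- 1) ^ n)"
    unfolding q_def cf_determinant ..
  finally have "\<bar>real_of_int q * cf_error x n - real_of_int (cf_continuant x n) * E\<bar> = 1"
    by simp
  moreover have "real_of_int q * cf_error x n - real_of_int (cf_continuant x n) * E
      = - (E * (real_of_int q * X + real_of_int (cf_continuant x n)))"
    unfolding E_def X_def by (subst cf_error_Suc[OF assms(1)]) (simp add: algebra_simps)
  ultimately have "\<bar>E\<bar> * \<bar>real_of_int q * X + real_of_int (cf_continuant x n)\<bar> = 1"
    by (simp add: abs_mult)
  moreover have "real_of_int q * X \<ge> real_of_int q * 1"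
    using q X by (intro mult_left_mono) auto
  then have "\<bar>E\<bar> * real_of_int q \<le> \<bar>E\<bar> * \<bar>real_of_int q * X + real_of_int (cf_continuant x n)\<bar>"
    using q' by (intro mult_left_mono) auto
  ultimately have "\<bar>E\<bar> * real_of_int q \<le> 1" by simp
  then show "\<bar>real_of_int q * x - real_of_int ?p\<bar> \<le> 1 / real_of_int q"
    using q unfolding E_def cf_error_def q_def by (simp add: field_simps)
qed

section \<open>The bounded ratio property\<close>

lemma strict_mono_cf_index:
  assumes "infinite (cf_large R x)"
  shows "strict_mono (cf_index R x)"
proof (rule strict_monoI_Suc)
  fix m show "cf_index R x m < cf_index R x (Suc m)"
  proof (cases m)
    case 0
    have "enumerate (cf_large R x) 0 \<in> cf_large R x" by (rule enumerate_in_set[OF assms])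
    then show ?thesis using 0 by (simp add: cf_large_def)
  next
    case (Suc k)
    then show ?thesis using enumerate_step[OF assms, of k] by simp
  qed
qed

lemma cf_index_Suc_large:
  assumes "infinite (cf_large R x)"
  shows "cf_index R x (Suc m) \<in> cf_large R x"
  using enumerate_in_set[OF assms] by simp

text \<open>This is what makes the gaps nonnegative and puts the end of one block below the start of
  the next.\<close>

lemma cf_continuant_large:
  assumes "x \<notin> \<rat>" "n \<in> cf_large R x"
  shows "(int R + 1) * cf_continuant x n \<le> cf_continuant x (Suc n)"
proof -
  obtain k where k: "n = Suc k" using assms(2) by (cases n) (auto simp: cf_large_def)
  have "(int R + 1) * cf_continuant x n \<le> cf_partial_quotient x n * cf_continuant x n"
    using assms(2) cf_continuant_nonneg[OF assms(1), of n] by (intro mult_right_mono) (auto simp: cf_large_def)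
  then show ?thesis
    unfolding k cf_continuant.simps using cf_continuant_nonneg[OF assms(1), of k] by linarith
qed

text \<open>With h = q_(k_m) and h' = q_(k_(m+1)), the block B_(m+1) lies in [h, h'] and adds at
  most (h' - h + 1) h'. Since h < h', this is at most 3 h'^2 - 3 h^2, so the bounds
  telescope.\<close>

lemma cf_block_sum_le:
  assumes x: "x \<notin> \<rat>" and inf: "infinite (cf_large R x)" and R: "R \<ge> 1"
  shows "int (cf_block_sum R x m) \<le> 3 * (cf_continuant x (cf_index R x m))\<^sup>2"
proof (induction m)
  case (Suc m)
  define h where "h = cf_continuant x (cf_index R x m)"
  define h' where "h' = cf_continuant x (cf_index R x (Suc m))"
  define lo where "lo = cf_continuant x (Suc (cf_index R x m)) - int R * h"
  have h: "h \<ge> 0" unfolding h_def using cf_continuant_nonneg[OF x] by blast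
  have idx: "Suc (cf_index R x m) \<le> cf_index R x (Suc m)"
    using strict_mono_cf_index[OF inf] by (simp add: strict_mono_Suc_iff Suc_le_eq del: cf_index.simps)
  have Suc_le: "cf_continuant x (Suc (cf_index R x m)) \<le> h'"
    unfolding h'_def by (rule cf_continuant_mono[OF x idx])
  have lo: "h \<le> lo" "h < h'"
  proof -
    show "h \<le> lo"
    proof (cases m)
      case (Suc k)
      show ?thesis
        using cf_continuant_large[OF x cf_index_Suc_large[OF inf, of k]]
        unfolding lo_def h_def Suc by (simp add: algebra_simps)
    qed (simp add: lo_def h_def)
    show "h < h'"
    proof (cases m)
      case 0
      then show ?thesis using Suc_le by (simp add: h_def)
    next
      case (Suc k)
      have "cf_index R x (Suc k) \<ge> 1"
        using cf_index_Suc_large[OF inf, of k] by (simp add: cf_large_def)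
      then have "h \<ge> 1" using cf_continuant_nonneg[OF x, of "cf_index R x m - 1"]
        by (simp add: h_def Suc del: cf_index.simps)
      have "2 * h \<le> (int R + 1) * h" using R h by (intro mult_right_mono) auto
      also have "\<dots> \<le> h'"
        using cf_continuant_large[OF x cf_index_Suc_large[OF inf, of k]] Suc_le
        by (simp add: h_def Suc del: cf_index.simps)
      finally show ?thesis using \<open>h \<ge> 1\<close> by simp
    qed
  qed
  \<comment> \<open>The guard in \<open>cf_block\<close> holds for every m because there are
    infinitely many large partial quotients; no block is unbounded.\<close>
  have block: "cf_block R x (Suc m) = {nat lo..nat h'}"
    using inf lo h by (auto simp: lo_def h_def h'_def simp del: cf_index.simps)
  have "(\<Sum>(cf_block R x (Suc m))) \<le> card {nat lo..nat h'} * nat h'"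
    unfolding block using sum_bounded_above[of "{nat lo..nat h'}" "\<lambda>x. x" "nat h'"] by simp
  then have "int (\<Sum>(cf_block R x (Suc m))) \<le> int (card {nat lo..nat h'} * nat h')"
    by linarith
  also have "\<dots> \<le> (h' - h + 1) * h'"
    using lo h by (simp add: of_nat_diff mult_right_mono)
  finally have b: "int (\<Sum>(cf_block R x (Suc m))) \<le> (h' - h + 1) * h'" .
  have "int (cf_block_sum R x (Suc m)) = int (cf_block_sum R x m) + int (\<Sum>(cf_block R x (Suc m)))"
    by (simp add: cf_block_sum_def del: cf_block.simps)
  also have "\<dots> \<le> 3 * h\<^sup>2 + (h' - h + 1) * h'"
    using Suc b unfolding h_def by linarith
  also have "\<dots> \<le> 3 * h'\<^sup>2"
  proof -
    \<comment> \<open>The right side minus the left side of the goal is (h' - h) (2 h' + 3 h) -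
      h'.\<close>
    have "(h' - h) * (2 * h' + 3 * h) \<ge> 1 * h'"
      using lo h by (intro mult_mono) auto
    then show ?thesis by (simp add: algebra_simps power2_eq_square)
  qed
  finally show ?case by (simp add: h'_def del: cf_index.simps)
qed (simp add: cf_block_sum_def)

text \<open>B_1 starts at q_0 - R q_(-1) = 1. Positivity matters because division by 0 yields 0, and
  a term of the ratio series with that value would bound nothing.\<close>

lemma cf_block_sum_pos:
  assumes x: "x \<notin> \<rat>" and inf: "infinite (cf_large R x)"
  shows "cf_block_sum R x (Suc m) \<ge> 1"
proof -
  have "cf_index R x (Suc 0) \<ge> 1"
    using cf_index_Suc_large[OF inf, of 0] by (simp add: cf_large_def)
  then have "cf_continuant x (cf_index R x (Suc 0)) \<ge> 1"
    using cf_continuant_nonneg[OF x, of "cf_index R x (Suc 0) - 1"] by simp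
  then have one: "1 \<in> cf_block R x 1" by simp
  have "finite (cf_block R x 1)"
    by (rule finite_subset[of _ "{..nat (cf_continuant x (cf_index R x 1))}"]) (use inf in auto)
  then have "1 \<le> \<Sum>(cf_block R x 1)"
    using member_le_sum[OF one, of "\<lambda>x. x"] by simp
  also have "\<dots> \<le> cf_block_sum R x (Suc m)"
    unfolding cf_block_sum_def using member_le_sum[of 1 "{1..Suc m}" "\<lambda>j. \<Sum>(cf_block R x j)"] by simp
  finally show ?thesis .
qed

text \<open>If a_(n+1) <= R, the term is at most (R + 1) / q_n, which is summable by exponential
  growth. If a_(n+1) > R, then q_(n+1) is (R + 1) q_n plus a gap, and gap / q_n^2 is at most 3 times
  a term of the bounded ratio series, by \<open>cf_block_sum_le\<close>.\<close>

lemma bounded_ratio_imp_summable: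
  assumes x: "x \<notin> \<rat>" and br: "bounded_ratio x"
  shows "summable (\<lambda>n. real_of_int (cf_continuant x (Suc (Suc n))) / (real_of_int (cf_continuant x (Suc n)))\<^sup>2)"
proof -
  define Q where "Q n = real_of_int (cf_continuant x n)" for n
  have Q: "Q (Suc n) \<ge> 1" "Q n \<ge> 0" for n
    using cf_continuant_nonneg[OF x, of n] by (auto simp: Q_def)
  have Q_mono: "Q n \<le> Q (Suc n)" for n
    using cf_continuant_mono[OF x, of n "Suc n"] by (simp add: Q_def del: cf_continuant.simps)
  from br obtain R where R: "R \<ge> 1"
    "finite (cf_large R x) \<or> summable (\<lambda>m. real_of_int (cf_gap R x (Suc m)) / real (cf_block_sum R x (Suc m)))"
    unfolding bounded_ratio_def by blast
  show ?thesis
  proof (cases "finite (cf_large R x)")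
    case True
    \<comment> \<open>With finitely many large partial quotients, T bounds all of them from index 1
      on, so every term is at most (T + 1) / q_n.\<close>
    define T where "T = Max (insert (int R) (cf_partial_quotient x ` cf_large R x))"
    have T: "cf_partial_quotient x (Suc n) \<le> T" for n
    proof (cases "Suc n \<in> cf_large R x")
      case True
      then show ?thesis unfolding T_def using \<open>finite (cf_large R x)\<close> by (intro Max_ge) auto
    next
      case False
      then have "cf_partial_quotient x (Suc n) \<le> int R" by (simp add: cf_large_def)
      also have "int R \<le> T" unfolding T_def using \<open>finite (cf_large R x)\<close> by (intro Max_ge) auto
      finally show ?thesis .
    qed
    show ?thesis
    proof (rule summable_comparison_test'[where N = 0])
      show "summable (\<lambda>n. (of_int T + 1) * (1 / real_of_int (cf_continuant x (Suc n))))"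
        by (intro summable_mult summable_inverse_cf_continuant[OF x])
      fix n
      have "Q (Suc (Suc n)) = of_int (cf_partial_quotient x (Suc n)) * Q (Suc n) + Q n"
        by (simp add: Q_def)
      also have "\<dots> \<le> of_int T * Q (Suc n) + Q (Suc n)"
        using Q Q_mono T[of n] by (intro add_mono mult_right_mono) auto
      finally have "Q (Suc (Suc n)) \<le> (of_int T + 1) * Q (Suc n)" by (simp add: algebra_simps)
      then have "Q (Suc (Suc n)) / (Q (Suc n))\<^sup>2 \<le> (of_int T + 1) * Q (Suc n) / (Q (Suc n))\<^sup>2"
        by (intro divide_right_mono) auto
      then show "norm (real_of_int (cf_continuant x (Suc (Suc n))) / (real_of_int (cf_continuant x (Suc n)))\<^sup>2)
          \<le> (of_int T + 1) * (1 / real_of_int (cf_continuant x (Suc n)))"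
        using Q(1)[of n] Q(1)[of "Suc n"] unfolding Q_def[symmetric]
        by (simp add: power2_eq_square)
    qed
  next
    case False
    then have inf: "infinite (cf_large R x)" by simp
    \<comment> \<open>\<open>e m\<close> is k_(m+1) itself, without the shift by one.\<close>
    define e where "e m = cf_index R x (Suc m) - 1" for m
    have idx: "cf_index R x (Suc m) = Suc (e m)" for m
      using cf_index_Suc_large[OF inf, of m] by (simp add: e_def cf_large_def)
    have large: "Suc (e m) \<in> cf_large R x" for m
      using cf_index_Suc_large[OF inf, of m] unfolding idx .
    have "strict_mono e"
      using strict_mono_cf_index[OF inf] by (simp only: strict_mono_Suc_iff) (metis Suc_less_eq idx)
    \<comment> \<open>Spreads the gap terms over all n, with 0 elsewhere, so that the series along
      \<open>e\<close> becomes a series over n (\<open>summable_mono_reindex\<close>).\<close>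
    define g where "g n = (if Suc n \<in> cf_large R x
        then (Q (Suc (Suc n)) - (real R + 1) * Q (Suc n)) / (Q (Suc n))\<^sup>2 else 0)" for n
    have range: "n \<in> range e" if S: "Suc n \<in> cf_large R x" for n
    proof -
      obtain m where "Suc n = enumerate (cf_large R x) m"
        using enumerate_Ex[OF inf S] by metis
      then have "n = e m" using idx[of m] by simp
      then show ?thesis by simp
    qed
    have "summable (\<lambda>m. g (e m))"
    proof (rule summable_comparison_test'[where N = 0])
      show "summable (\<lambda>m. 3 * (real_of_int (cf_gap R x (Suc m)) / real (cf_block_sum R x (Suc m))))"
        using R(2) inf by (intro summable_mult) simp
      fix m
      have gap: "real_of_int (cf_gap R x (Suc m)) = Q (Suc (Suc (e m))) - (real R + 1) * Q (Suc (e m))"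
        unfolding cf_gap_def idx Q_def by simp
      have pos: "cf_gap R x (Suc m) \<ge> 0"
        unfolding cf_gap_def idx using cf_continuant_large[OF x large[of m]] by simp
      have sum_le: "real (cf_block_sum R x (Suc m)) \<le> 3 * (Q (Suc (e m)))\<^sup>2"
      proof -
        have "real_of_int (int (cf_block_sum R x (Suc m))) \<le> real_of_int (3 * (cf_continuant x (cf_index R x (Suc m)))\<^sup>2)"
          by (subst of_int_le_iff) (rule cf_block_sum_le[OF x inf R(1)])
        then show ?thesis unfolding idx by (simp add: Q_def)
      qed
      have "real_of_int (cf_gap R x (Suc m)) / (3 * (Q (Suc (e m)))\<^sup>2)
          \<le> real_of_int (cf_gap R x (Suc m)) / real (cf_block_sum R x (Suc m))"
        proof (rule divide_left_mono[OF sum_le])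
        have "real (cf_block_sum R x (Suc m)) \<ge> 1"
          using cf_block_sum_pos[OF x inf, of m] by linarith
        moreover have "3 * (Q (Suc (e m)))\<^sup>2 > 0"
          using Q(1)[of "e m"] by (intro mult_pos_pos zero_less_power) linarith+
        ultimately show "3 * (Q (Suc (e m)))\<^sup>2 * real (cf_block_sum R x (Suc m)) > 0"
          by (intro mult_pos_pos) linarith+
      qed (use pos in simp)
      moreover have "g (e m) = real_of_int (cf_gap R x (Suc m)) / (Q (Suc (e m)))\<^sup>2"
        unfolding gap g_def using large by simp
      moreover have "g (e m) \<ge> 0"
        using calculation(2) pos by simp
      ultimately show "norm (g (e m)) \<le> 3 * (real_of_int (cf_gap R x (Suc m)) / real (cf_block_sum R x (Suc m)))"
        by simp
    qed
    then have "summable g"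
    proof (subst (asm) summable_mono_reindex[OF \<open>strict_mono e\<close>])
      fix n assume "n \<notin> range e"
      then have "Suc n \<notin> cf_large R x" using range by blast
      then show "g n = 0" by (simp add: g_def)
    qed
    show ?thesis
    proof (rule summable_comparison_test'[where N = 0])
      show "summable (\<lambda>n. (real R + 1) * (1 / real_of_int (cf_continuant x (Suc n))) + g n)"
        by (intro summable_add summable_mult summable_inverse_cf_continuant[OF x] \<open>summable g\<close>)
      fix n
      have "Q (Suc (Suc n)) / (Q (Suc n))\<^sup>2 \<le> (real R + 1) * (1 / Q (Suc n)) + g n"
      proof (cases "Suc n \<in> cf_large R x")
        case True
        then show ?thesis using Q(1)[of n] by (simp add: g_def field_simps power2_eq_square)
      next
        case False
        then have a: "cf_partial_quotient x (Suc n) \<le> int R" by (simp add: cf_large_def)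
        have "Q (Suc (Suc n)) = of_int (cf_partial_quotient x (Suc n)) * Q (Suc n) + Q n"
          by (simp add: Q_def)
        also have "\<dots> \<le> real R * Q (Suc n) + Q (Suc n)"
        proof -
          have "real_of_int (cf_partial_quotient x (Suc n)) \<le> real R" using a by linarith
          then show ?thesis using Q(2) Q_mono by (intro add_mono mult_right_mono)
        qed
        finally have "Q (Suc (Suc n)) \<le> (real R + 1) * Q (Suc n)" by (simp add: algebra_simps)
        then have "Q (Suc (Suc n)) / (Q (Suc n))\<^sup>2 \<le> (real R + 1) * Q (Suc n) / (Q (Suc n))\<^sup>2"
          by (intro divide_right_mono) auto
        then show ?thesis using False Q(1)[of n] by (simp add: g_def power2_eq_square)
      qed
      then show "norm (real_of_int (cf_continuant x (Suc (Suc n))) / (real_of_int (cf_continuant x (Suc n)))\<^sup>2)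
          \<le> (real R + 1) * (1 / real_of_int (cf_continuant x (Suc n))) + g n"
        using Q(1)[of n] Q(1)[of "Suc n"] unfolding Q_def[symmetric] by simp
    qed
  qed
qed

section \<open>Multiples of an irrational number close to integers\<close>

definition near_int :: "real \<Rightarrow> real \<Rightarrow> bool" where
  "near_int \<delta> t \<longleftrightarrow> (\<exists>p::int. \<bar>t - of_int p\<bar> < \<delta>)"

lemma near_int_mono: "near_int \<delta> t \<Longrightarrow> \<delta> \<le> \<epsilon> \<Longrightarrow> near_int \<epsilon> t"
  unfolding near_int_def by (meson less_le_trans)

lemma near_int_pos: "near_int \<delta> t \<Longrightarrow> \<delta> > 0"
  unfolding near_int_def by (meson abs_ge_zero le_less_trans)

section \<open>Upper bound for the restricted sum\<close>

text \<open>Replace c by p / q. Coprimality and 0 < h < q make h p / q - m a nonzero multiple of 1 /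
  q, and the replacement costs at most h / q^2 <= 1 / (2 q).\<close>

lemma dist_int_ge_convergent:
  fixes p q h m :: int
  assumes q: "q \<ge> 1" and pq: "coprime p q" "\<bar>of_int q * c - of_int p\<bar> \<le> 1 / of_int q"
    and h: "0 < h" "2 * h \<le> q"
  shows "\<bar>of_int h * c - of_int m\<bar> \<ge> 1 / (2 * real_of_int q)"
proof -
  have "h * p \<noteq> m * q"
  proof
    assume "h * p = m * q"
    then have "q dvd h * p" by simp
    then have "q dvd h" using pq(1) by (simp add: coprime_commute coprime_dvd_mult_left_iff)
    then have "q \<le> h" using h(1) by (rule zdvd_imp_le)
    with h show False by linarith
  qed
  then have "1 \<le> \<bar>h * p - m * q\<bar>" by linarith
  then have 1: "1 \<le> \<bar>real_of_int h * of_int p - of_int m * of_int q\<bar>"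
    by (metis of_int_1_le_iff of_int_abs of_int_diff of_int_mult)
  have "real_of_int h * \<bar>of_int q * c - of_int p\<bar> \<le> real_of_int h * (1 / of_int q)"
    using pq(2) h(1) by (intro mult_left_mono) auto
  also have "\<dots> \<le> 1 / 2"
    using q h by (simp add: field_simps flip: of_int_mult)
  finally have 2: "\<bar>real_of_int h * (of_int q * c - of_int p)\<bar> \<le> 1 / 2"
    using h(1) by (simp add: abs_mult)
  have "real_of_int q * (of_int h * c - of_int m)
      = real_of_int h * (of_int q * c - of_int p) + (real_of_int h * of_int p - of_int m * of_int q)"
    by (simp add: algebra_simps)
  then have "\<bar>real_of_int q * (of_int h * c - of_int m)\<bar> \<ge> 1 / 2"
    using 1 2 by linarith
  then have "real_of_int q * \<bar>of_int h * c - of_int m\<bar> \<ge> 1 / 2"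
    using q by (simp add: abs_mult)
  then show ?thesis using q by (simp add: field_simps)
qed

text \<open>Cut the interval around 0 of radius \<delta> into cells of length 1 / (2 q). Two
  elements of the window differ by at most L - 1 <= q / 2, so by
  \<open>dist_int_ge_convergent\<close> their signed distances to the nearby integers are at least
  one cell length apart and lie in different cells.\<close>

lemma card_near_int_window:
  fixes p q :: int and a L :: nat
  assumes q: "q \<ge> 1" and pq: "coprime p q" "\<bar>of_int q * c - of_int p\<bar> \<le> 1 / of_int q"
    and L: "2 * int L \<le> q + 1" and d: "\<delta> \<ge> 0"
  shows "real (card {x \<in> {a<..a + L}. near_int \<delta> (real x * c)}) \<le> 4 * \<delta> * of_int q + 2"
proof -
  let ?A = "{x \<in> {a<..a + L}. near_int \<delta> (real x * c)}"
  have "\<forall>x. \<exists>p::int. x \<in> ?A \<longrightarrow> \<bar>real x * c - of_int p\<bar> < \<delta>"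
    by (auto simp: near_int_def)
  then obtain P :: "nat \<Rightarrow> int" where P: "\<And>x. x \<in> ?A \<Longrightarrow> \<bar>real x * c - of_int (P x)\<bar> < \<delta>"
    by metis
  define f where "f x = \<lfloor>2 * of_int q * (real x * c - of_int (P x))\<rfloor>" for x
  have neq: "f x \<noteq> f y" if "x \<in> ?A" "y \<in> ?A" "x < y" for x y
  proof
    assume "f x = f y"
    then have "\<bar>2 * of_int q * (real y * c - of_int (P y)) - 2 * of_int q * (real x * c - of_int (P x))\<bar> < 1"
      unfolding f_def by linarith
    then have "\<bar>2 * of_int q * (of_int (int y - int x) * c - of_int (P y - P x))\<bar> < 1"
      by (simp add: algebra_simps)
    moreover have "1 / (2 * real_of_int q) \<le> \<bar>of_int (int y - int x) * c - of_int (P y - P x)\<bar>"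
      using that L by (intro dist_int_ge_convergent[OF q pq]) auto
    then have "1 \<le> 2 * of_int q * \<bar>of_int (int y - int x) * c - of_int (P y - P x)\<bar>"
      using q by (simp add: field_simps)
    ultimately show False
      using q by (simp only: abs_mult)
  qed
  then have "inj_on f ?A"
    by (intro linorder_inj_onI') blast+
  moreover have "f ` ?A \<subseteq> {\<lfloor>- (2 * of_int q * \<delta>)\<rfloor>..\<lfloor>2 * of_int q * \<delta>\<rfloor>}"
  proof
    fix y assume "y \<in> f ` ?A"
    then obtain x where x: "x \<in> ?A" "y = f x" by blast
    have "\<bar>2 * of_int q * (real x * c - of_int (P x))\<bar> \<le> 2 * of_int q * \<delta>"
      using P[OF x(1)] q by (simp add: abs_mult)
    then have "- (2 * of_int q * \<delta>) \<le> 2 * of_int q * (real x * c - of_int (P x))"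
        "2 * of_int q * (real x * c - of_int (P x)) \<le> 2 * of_int q * \<delta>"
      by linarith+
    then show "y \<in> {\<lfloor>- (2 * of_int q * \<delta>)\<rfloor>..\<lfloor>2 * of_int q * \<delta>\<rfloor>}"
      unfolding x(2) f_def by (simp add: floor_mono)
  qed
  ultimately have "card ?A \<le> card {\<lfloor>- (2 * of_int q * \<delta>)\<rfloor>..\<lfloor>2 * of_int q * \<delta>\<rfloor>}"
    by (intro card_inj_on_le) auto
  also have "\<dots> = nat (\<lfloor>2 * of_int q * \<delta>\<rfloor> - \<lfloor>- (2 * of_int q * \<delta>)\<rfloor> + 1)"
    by simp
  finally have "real (card ?A) \<le> real (nat (\<lfloor>2 * of_int q * \<delta>\<rfloor> - \<lfloor>- (2 * of_int q * \<delta>)\<rfloor> + 1))"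
    by simp
  \<comment> \<open>With a = 2 q \<delta>, the number of cells is floor a + ceiling a + 1 <= 2 a +
    2.\<close>
  also have "\<dots> \<le> 4 * \<delta> * of_int q + 2"
  proof -
    have "2 * of_int q * \<delta> \<ge> 0" using q d by simp
    then have "\<lfloor>2 * of_int q * \<delta>\<rfloor> - \<lfloor>- (2 * of_int q * \<delta>)\<rfloor> + 1 \<ge> 0" by linarith
    then have "real (nat (\<lfloor>2 * of_int q * \<delta>\<rfloor> - \<lfloor>- (2 * of_int q * \<delta>)\<rfloor> + 1))
       = real_of_int (\<lfloor>2 * of_int q * \<delta>\<rfloor> - \<lfloor>- (2 * of_int q * \<delta>)\<rfloor> + 1)"
      by simp
    also have "\<dots> \<le> 4 * \<delta> * of_int q + 2" by (simp add: algebra_simps) linarith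
    finally show ?thesis .
  qed
  finally show ?thesis .
qed

text \<open>Radius 0 encodes the exclusion of q, because \<open>near_int 0 t\<close> never holds.
  Even for monotone \<psi> the result need not be monotone.\<close>

definition restrict_near :: "real \<Rightarrow> (nat \<Rightarrow> real) \<Rightarrow> nat \<Rightarrow> real" where
  "restrict_near c \<psi> q = (if near_int (\<psi> q) (real q * c) then \<psi> q else 0)"

text \<open>The value \<delta> of \<psi> at b + L bounds \<psi> from above on this window and from
  below on the preceding one. The power n here can be traded for n + 1 there because the number of
  near points brings in another factor \<delta>.\<close>

lemma sum_window_le:
  fixes p q :: int and b L n :: nat
  assumes q: "q \<ge> 1" and pq: "coprime p q" "\<bar>of_int q * c - of_int p\<bar> \<le> 1 / of_int q"
    and L: "2 * int L \<le> q + 1" "L \<ge> 1" and n: "n \<ge> 1" and psi: "approximating_function \<psi>"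
  shows "(\<Sum>x\<in>{b + L<..b + L + L}. restrict_near c \<psi> x ^ n)
    \<le> 6 / of_int q + 6 * (of_int q / real L) * (\<Sum>x\<in>{b<..b + L}. \<psi> x ^ Suc n)"
proof -
  define a where "a = b + L"
  define \<delta> where "\<delta> = \<psi> a"
  have a: "a \<ge> 1" using L(2) by (simp add: a_def)
  have psi0: "\<psi> x \<ge> 0" if "x \<ge> 1" for x using psi that by (auto simp: approximating_function_def)
  have anti: "\<psi> y \<le> \<psi> x" if "x \<ge> 1" "x \<le> y" for x y using psi that by (auto simp: approximating_function_def)
  have d0: "\<delta> \<ge> 0" using psi0[OF a] by (simp add: \<delta>_def)
  let ?A = "{x \<in> {a<..a + L}. near_int \<delta> (real x * c)}"
  have "(\<Sum>x\<in>{a<..a + L}. restrict_near c \<psi> x ^ n) \<le> (\<Sum>x\<in>{a<..a + L}. if x \<in> ?A then \<delta> ^ n else 0)"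
  proof (rule sum_mono)
    fix x assume x: "x \<in> {a<..a + L}"
    have le: "\<psi> x \<le> \<delta>" "0 \<le> \<psi> x" unfolding \<delta>_def using anti[of a x] psi0[of x] a x by auto
    show "restrict_near c \<psi> x ^ n \<le> (if x \<in> ?A then \<delta> ^ n else 0)"
    proof (cases "near_int (\<psi> x) (real x * c)")
      case True
      then have "x \<in> ?A" using near_int_mono[OF True le(1)] x by simp
      then show ?thesis using True le by (simp add: restrict_near_def power_mono)
    qed (use n d0 in \<open>simp add: restrict_near_def power_0_left\<close>)
  qed
  also have "\<dots> = real (card ?A) * \<delta> ^ n"
    by (simp add: sum.If_cases Int_def conj_assoc)
  also have "\<dots> \<le> (4 * \<delta> * of_int q + 2) * \<delta> ^ n"
    using card_near_int_window[OF q pq L(1) d0] d0 by (intro mult_right_mono) auto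
  also have "\<dots> \<le> 6 / of_int q + 6 * (of_int q / real L) * (\<Sum>x\<in>{b<..b + L}. \<psi> x ^ Suc n)"
  proof -
    have S0: "(\<Sum>x\<in>{b<..b + L}. \<psi> x ^ Suc n) \<ge> 0"
      using psi0 by (intro sum_nonneg zero_le_power) auto
    show ?thesis
    proof (cases "\<delta> * of_int q < 1")
      \<comment> \<open>The count is at most 6, and each point contributes at most \<delta> < 1 /
        q.\<close>
      case True
      have "\<delta> * 1 \<le> \<delta> * real_of_int q" using q d0 by (intro mult_left_mono) auto
      then have "\<delta> < 1" using True by simp
      then have "\<delta> ^ n \<le> \<delta> ^ 1" using n d0 by (intro power_decreasing) auto
      then have "(4 * \<delta> * of_int q + 2) * \<delta> ^ n \<le> 6 * \<delta>"
        using True d0 q by (intro mult_mono) auto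
      also have "\<dots> \<le> 6 / of_int q" using True q by (simp add: field_simps)
      moreover have "6 * (of_int q / real L) * (\<Sum>x\<in>{b<..b + L}. \<psi> x ^ Suc n) \<ge> 0"
        using S0 q by (intro mult_nonneg_nonneg divide_nonneg_nonneg) auto
      ultimately show ?thesis by linarith
    next
      \<comment> \<open>Now 2 <= 2 \<delta> q, so the total is at most 6 q \<delta>^(n+1), while the
        preceding window sums to at least L \<delta>^(n+1).\<close>
      case False
      have "(4 * \<delta> * of_int q + 2) * \<delta> ^ n \<le> (6 * \<delta> * of_int q) * \<delta> ^ n"
        using False d0 by (intro mult_right_mono) auto
      also have "\<dots> = 6 * (of_int q / real L) * (real L * \<delta> ^ Suc n)" using L(2) by simp
      also have "6 * (of_int q / real L) * (real L * \<delta> ^ Suc n)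
          \<le> 6 * (of_int q / real L) * (\<Sum>x\<in>{b<..b + L}. \<psi> x ^ Suc n)"
      proof -
        have "(\<Sum>x\<in>{b<..b + L}. \<delta> ^ Suc n) \<le> (\<Sum>x\<in>{b<..b + L}. \<psi> x ^ Suc n)"
          using anti d0 unfolding \<delta>_def a_def by (intro sum_mono power_mono) auto
        then show ?thesis using q by (intro mult_left_mono) auto
      qed
      finally have "(4 * \<delta> * of_int q + 2) * \<delta> ^ n
          \<le> 6 * (of_int q / real L) * (\<Sum>x\<in>{b<..b + L}. \<psi> x ^ Suc n)" .
      moreover have "6 / real_of_int q \<ge> 0" using q by simp
      ultimately show ?thesis by linarith
    qed
  qed
  finally show ?thesis by (simp add: a_def)
qed

lemma sum_greaterThanAtMost_split:
  fixes f :: "nat \<Rightarrow> real"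
  assumes "a \<le> b" "b \<le> c"
  shows "sum f {a<..c} = sum f {a<..b} + sum f {b<..c}"
  using assms by (subst sum.union_disjoint[symmetric]) (auto simp: ivl_disj_un)

lemma sum_windows_le:
  fixes p q :: int and b L n M :: nat
  assumes q: "q \<ge> 1" and pq: "coprime p q" "\<bar>of_int q * c - of_int p\<bar> \<le> 1 / of_int q"
    and L: "2 * int L \<le> q + 1" "L \<ge> 1" and n: "n \<ge> 1" and psi: "approximating_function \<psi>"
  shows "(\<Sum>x\<in>{b + L<..b + L + M * L}. restrict_near c \<psi> x ^ n)
    \<le> real M * (6 / of_int q) + 6 * (of_int q / real L) * (\<Sum>x\<in>{b<..b + M * L}. \<psi> x ^ Suc n)"
proof (induction M)
  case (Suc M)
  define B where "B = b + M * L"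
  have "(\<Sum>x\<in>{b + L<..b + L + Suc M * L}. restrict_near c \<psi> x ^ n)
      = (\<Sum>x\<in>{b + L<..b + L + M * L}. restrict_near c \<psi> x ^ n)
        + (\<Sum>x\<in>{B + L<..B + L + L}. restrict_near c \<psi> x ^ n)"
    by (subst sum_greaterThanAtMost_split[of _ "b + L + M * L"]) (simp_all add: B_def algebra_simps)
  also have "\<dots> \<le> (real M * (6 / of_int q) + 6 * (of_int q / real L) * (\<Sum>x\<in>{b<..b + M * L}. \<psi> x ^ Suc n))
      + (6 / of_int q + 6 * (of_int q / real L) * (\<Sum>x\<in>{B<..B + L}. \<psi> x ^ Suc n))"
    by (intro add_mono Suc.IH sum_window_le[OF q pq L n psi])
  also have "\<dots> = real (Suc M) * (6 / of_int q)
      + 6 * (of_int q / real L) * ((\<Sum>x\<in>{b<..B}. \<psi> x ^ Suc n) + (\<Sum>x\<in>{B<..B + L}. \<psi> x ^ Suc n))"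
    by (simp only: B_def) (simp add: algebra_simps add_divide_distrib)
  also have "(\<Sum>x\<in>{b<..B}. \<psi> x ^ Suc n) + (\<Sum>x\<in>{B<..B + L}. \<psi> x ^ Suc n)
      = (\<Sum>x\<in>{b<..b + Suc M * L}. \<psi> x ^ Suc n)"
    by (subst sum_greaterThanAtMost_split[of b B "b + Suc M * L"]) (simp_all add: B_def algebra_simps)
  finally show ?case .
qed simp

lemma restrict_near_nonneg: "restrict_near c \<psi> q \<ge> 0"
  using near_int_pos[of "\<psi> q"] by (simp add: restrict_near_def less_imp_le)

text \<open>Windows of length L = N div 2 cover (N, N'], the last one possibly sticking out. Shifted
  left by L they start at N - L >= N / 2 and end no later than N', so they stay inside (N1, N']. The
  estimate N <= 3 L turns the constants 6 into 18.\<close>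

lemma sum_range_le:
  fixes p :: int and N1 N N' n :: nat
  assumes N: "N \<ge> 2" and pq: "coprime p (int N)" "\<bar>real N * c - of_int p\<bar> \<le> 1 / real N"
    and le: "2 * N1 \<le> N" "N \<le> N'" and n: "n \<ge> 1" and psi: "approximating_function \<psi>"
  shows "(\<Sum>x\<in>{N<..N'}. restrict_near c \<psi> x ^ n)
    \<le> 18 * (real N' / (real N)\<^sup>2) + 18 * (\<Sum>x\<in>{N1<..N'}. \<psi> x ^ Suc n)"
proof -
  define L where "L = N div 2"
  define b where "b = N - L"
  define M where "M = (N' - N) div L + 1"
  have L: "L \<ge> 1" "2 * L \<le> N" "N \<le> 3 * L" using N by (auto simp: L_def)
  have bL: "b + L = N" using L by (simp add: b_def)
  have mL: "(N' - N) \<le> M * L" "M * L \<le> (N' - N) + L"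
  proof -
    have "(N' - N) div L * L + (N' - N) mod L = N' - N" by (rule div_mult_mod_eq)
    moreover have "(N' - N) mod L < L" using L by simp
    moreover have "M * L = (N' - N) div L * L + L" by (simp add: M_def)
    ultimately show "(N' - N) \<le> M * L" "M * L \<le> (N' - N) + L"
      by linarith+
  qed
  have psi0: "\<psi> x \<ge> 0" if "x \<ge> 1" for x using psi that by (auto simp: approximating_function_def)
  have S0: "(\<Sum>x\<in>{N1<..N'}. \<psi> x ^ Suc n) \<ge> 0"
    using psi0 by (intro sum_nonneg zero_le_power) auto
  have "(\<Sum>x\<in>{N<..N'}. restrict_near c \<psi> x ^ n) \<le> (\<Sum>x\<in>{b + L<..b + L + M * L}. restrict_near c \<psi> x ^ n)"
    unfolding bL using mL by (intro sum_mono2) (auto simp: restrict_near_nonneg)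
  also have "\<dots> \<le> real M * (6 / of_int (int N)) + 6 * (of_int (int N) / real L) * (\<Sum>x\<in>{b<..b + M * L}. \<psi> x ^ Suc n)"
    using N L pq n psi by (intro sum_windows_le) auto
  finally have 1: "(\<Sum>x\<in>{N<..N'}. restrict_near c \<psi> x ^ n)
    \<le> real M * (6 / of_int (int N)) + 6 * (of_int (int N) / real L) * (\<Sum>x\<in>{b<..b + M * L}. \<psi> x ^ Suc n)" .
  have 2: "(\<Sum>x\<in>{b<..b + M * L}. \<psi> x ^ Suc n) \<le> (\<Sum>x\<in>{N1<..N'}. \<psi> x ^ Suc n)"
    using mL le L psi0 bL by (intro sum_mono2 zero_le_power) auto
  have 3: "6 * (of_int (int N) / real L) * (\<Sum>x\<in>{N1<..N'}. \<psi> x ^ Suc n)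
      \<le> 18 * (\<Sum>x\<in>{N1<..N'}. \<psi> x ^ Suc n)"
  proof (rule mult_right_mono[OF _ S0])
    have "real N \<le> 3 * real L" using L(3) by linarith
    then show "6 * (of_int (int N) / real L) \<le> 18" using L(1) by (simp add: field_simps)
  qed
  have 4: "real M * (6 / of_int (int N)) \<le> 18 * (real N' / (real N)\<^sup>2)"
  proof -
    have "real M * real N \<le> real M * (3 * real L)"
      using L(3) by (intro mult_left_mono) linarith+
    also have "\<dots> = 3 * real (M * L)" by simp
    also have "\<dots> \<le> 3 * real ((N' - N) + L)"
      by (rule mult_left_mono[OF of_nat_mono[OF mL(2)]]) simp
    also have "\<dots> \<le> 3 * real N'"
    proof -
      have "(N' - N) + L \<le> N'" using le L by linarith
      show ?thesis by (rule mult_left_mono[OF of_nat_mono[OF \<open>(N' - N) + L \<le> N'\<close>]]) simp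
    qed
    finally have "real M * real N \<le> 3 * real N'" .
    then show ?thesis using N by (simp add: field_simps power2_eq_square)
  qed
  have "6 * (of_int (int N) / real L) * (\<Sum>x\<in>{b<..b + M * L}. \<psi> x ^ Suc n)
      \<le> 6 * (of_int (int N) / real L) * (\<Sum>x\<in>{N1<..N'}. \<psi> x ^ Suc n)"
    using 2 by (rule mult_left_mono) simp
  with 1 3 4 show ?thesis by linarith
qed

text \<open>Since q_k >= 2 q_(k-2), the sum over (q_k, q_(k+1)] is compared with the one over
  (q_(k-2), q_(k+1)], which spans three consecutive ranges; each value of \<psi>^(n+1) is therefore
  counted at most three times.\<close>

lemma summable_restrict_near:
  assumes c: "c \<notin> \<rat>" and br: "bounded_ratio c" and psi: "approximating_function \<psi>" and n: "n \<ge> 1"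
    and sum: "summable (\<lambda>q. \<psi> (Suc q) ^ Suc n)"
  shows "summable (\<lambda>q. restrict_near c \<psi> q ^ n)"
proof -
  define N where "N k = nat (cf_continuant c k)" for k
  have N: "int (N k) = cf_continuant c k" for k
    using cf_continuant_nonneg[OF c, of k] by (simp add: N_def)
  have N_pos: "N (Suc k) \<ge> 1" for k
    using cf_continuant_nonneg[OF c, of k] N[of "Suc k"] by linarith
  have N_add: "N (Suc k) + N k \<le> N (Suc (Suc k))" for k
    using cf_continuant_add_le[OF c, of k] N[of k] N[of "Suc k"] N[of "Suc (Suc k)"] by linarith
  have N_mono: "N k \<le> N (Suc k)" for k
    using cf_continuant_mono[OF c, of k "Suc k"] N[of k] N[of "Suc k"] by linarith
  have N_ge: "k \<le> N (Suc k)" for k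
  proof (induction k rule: induct_nat_012)
    case (ge2 k)
    then show ?case using N_add[of "Suc k"] N_pos[of k] by linarith
  qed (use N_pos[of 1] in auto)
  define t where "t k = 18 * (real (N (Suc (Suc k))) / (real (N (Suc k)))\<^sup>2)" for k
  have t0: "t k \<ge> 0" for k by (simp add: t_def)
  have real_N: "real (N k) = real_of_int (cf_continuant c k)" for k
    using N[of k] by (metis of_int_of_nat_eq)
  have sum_t: "summable t"
    unfolding t_def real_N by (intro summable_mult bounded_ratio_imp_summable[OF c br])
  define G where "G m = (\<Sum>x\<in>{0<..m}. \<psi> x ^ Suc n)" for m
  have psi0: "\<psi> x \<ge> 0" if "x \<ge> 1" for x using psi that by (auto simp: approximating_function_def)
  define C where "C = (\<Sum>q. \<psi> (Suc q) ^ Suc n)"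
  have G: "0 \<le> G m" "G m \<le> C" for m
  proof -
    show "0 \<le> G m" unfolding G_def using psi0 by (intro sum_nonneg zero_le_power) auto
    have "G m = (\<Sum>x<m. \<psi> (Suc x) ^ Suc n)"
      unfolding G_def by (rule sum.reindex_bij_witness[of _ Suc "\<lambda>x. x - 1"]) auto
    also have "\<dots> \<le> C" unfolding C_def
      using psi0 by (intro sum_le_suminf[OF sum]) auto
    finally show "G m \<le> C" .
  qed
  have G_diff: "(\<Sum>x\<in>{a<..b}. \<psi> x ^ Suc n) = G b - G a" if "a \<le> b" for a b
    unfolding G_def using sum_greaterThanAtMost_split[of 0 a b "\<lambda>x. \<psi> x ^ Suc n"] that by simp
  define u where "u k = G (N (Suc k))" for k
  \<comment> \<open>\<open>N 3\<close> is the first of these continuants that is certainly at least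
    2, as \<open>sum_range_le\<close> demands.\<close>
  have step: "(\<Sum>x\<in>{N (k + 3)<..N (k + 4)}. restrict_near c \<psi> x ^ n) \<le> t (k + 2) + 18 * (u (k + 3) - u k)" for k
  proof -
    obtain p where p: "coprime p (cf_continuant c (Suc (k + 2)))"
      "\<bar>real_of_int (cf_continuant c (Suc (k + 2))) * c - real_of_int p\<bar> \<le> 1 / real_of_int (cf_continuant c (Suc (k + 2)))"
      using cf_convergent[OF c, of "k + 2"] by blast
    have 1: "N (k + 3) \<ge> 2"
      using N_add[of "Suc k"] N_pos[of k] N_pos[of "Suc k"] by (simp add: numeral_3_eq_3)
    have 2: "2 * N (k + 1) \<le> N (k + 3)"
      using N_add[of "Suc k"] N_mono[of "Suc k"] by (simp add: numeral_3_eq_3)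
    have 3: "N (k + 3) \<le> N (k + 4)" using N_mono[of "k + 3"] by (simp add: numeral_eq_Suc)
    have "(\<Sum>x\<in>{N (k + 3)<..N (k + 4)}. restrict_near c \<psi> x ^ n)
        \<le> 18 * (real (N (k + 4)) / (real (N (k + 3)))\<^sup>2) + 18 * (\<Sum>x\<in>{N (k + 1)<..N (k + 4)}. \<psi> x ^ Suc n)"
    proof (rule sum_range_le[OF 1 _ _ 2 3 n psi])
      show "coprime p (int (N (k + 3)))" using p(1) unfolding N by (simp add: numeral_3_eq_3)
      show "\<bar>real (N (k + 3)) * c - real_of_int p\<bar> \<le> 1 / real (N (k + 3))"
        using p(2) unfolding real_N by (simp add: numeral_3_eq_3)
    qed
    also have "(\<Sum>x\<in>{N (k + 1)<..N (k + 4)}. \<psi> x ^ Suc n) = u (k + 3) - u k"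
      using 2 3 by (subst G_diff) (auto simp: u_def numeral_eq_Suc)
    also have "18 * (real (N (k + 4)) / (real (N (k + 3)))\<^sup>2) = t (k + 2)"
      by (simp add: t_def numeral_eq_Suc)
    finally show ?thesis .
  qed
  \<comment> \<open>The differences u (k + 3) - u k telescope in strides of three. Three final
    values remain, and the initial ones are dropped as nonnegative.\<close>
  have partial: "(\<Sum>x\<in>{N 3<..N (K + 3)}. restrict_near c \<psi> x ^ n)
      \<le> (\<Sum>k<K. t (k + 2)) + 18 * (u K + u (K + 1) + u (K + 2))" for K
  proof (induction K)
    case 0
    then show ?case using G(1) by (simp add: u_def)
  next
    case (Suc K)
    have "N 3 \<le> N (K + 3)" by (rule lift_Suc_mono_le[of N]) (use N_mono in auto)
    then have "(\<Sum>x\<in>{N 3<..N (Suc K + 3)}. restrict_near c \<psi> x ^ n)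
      = (\<Sum>x\<in>{N 3<..N (K + 3)}. restrict_near c \<psi> x ^ n) + (\<Sum>x\<in>{N (K + 3)<..N (K + 4)}. restrict_near c \<psi> x ^ n)"
      using N_mono[of "K + 3"] by (subst sum_greaterThanAtMost_split[of _ "N (K + 3)"]) (auto simp: numeral_eq_Suc)
    then show ?case using Suc step[of K] by (simp add: numeral_eq_Suc)
  qed
  show ?thesis
  proof (rule summableI_nonneg_bounded)
    fix K
    have "N 3 \<le> N (K + 3)" by (rule lift_Suc_mono_le[of N]) (use N_mono in auto)
    moreover have "K \<le> N (K + 3)" using N_ge[of "K + 2"] by (simp add: numeral_3_eq_3)
    ultimately have "{..<K} \<subseteq> {..N 3} \<union> {N 3<..N (K + 3)}" by auto
    then have "(\<Sum>x<K. restrict_near c \<psi> x ^ n) \<le> (\<Sum>x\<in>{..N 3} \<union> {N 3<..N (K + 3)}. restrict_near c \<psi> x ^ n)"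
      by (intro sum_mono2) (auto simp: restrict_near_nonneg)
    also have "\<dots> = (\<Sum>x\<le>N 3. restrict_near c \<psi> x ^ n) + (\<Sum>x\<in>{N 3<..N (K + 3)}. restrict_near c \<psi> x ^ n)"
      by (intro sum.union_disjoint) auto
    also have "(\<Sum>x\<in>{N 3<..N (K + 3)}. restrict_near c \<psi> x ^ n)
        \<le> (\<Sum>k<K. t (k + 2)) + 18 * (u K + u (K + 1) + u (K + 2))"
      by (rule partial)
    also have "(\<Sum>k<K. t (k + 2)) \<le> (\<Sum>k. t (k + 2))"
      using sum_t t0 by (intro sum_le_suminf) (auto intro: summable_ignore_initial_segment simp del: add_2_eq_Suc')
    also have "18 * (u K + u (K + 1) + u (K + 2)) \<le> 18 * (C + C + C)"
      unfolding u_def using G(2) by (intro mult_left_mono add_mono) auto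
    finally show "(\<Sum>x<K. restrict_near c \<psi> x ^ n)
      \<le> (\<Sum>x\<le>N 3. restrict_near c \<psi> x ^ n) + ((\<Sum>k. t (k + 2)) + 18 * (C + C + C))"
      by simp
  qed (simp add: restrict_near_nonneg)
qed

section \<open>Lower bound for the restricted sum\<close>

text \<open>There are N + 1 multiples and K boxes of length 1 / K <= \<delta>. A whole box with at
  least the average number of members is kept: subtracting its least member from the others gives (N
  + 1) / K - 1 or more distinct q, and K <= 2 / \<delta> because \<delta> <= 1.\<close>

lemma card_near_int_ge:
  fixes c \<delta> :: real
  assumes d: "0 < \<delta>" "\<delta> \<le> 1"
  shows "real N * \<delta> / 2 - 1 \<le> real (card {q \<in> {1..N}. near_int \<delta> (real q * c)})"
proof -
  define K where "K = nat \<lceil>1 / \<delta>\<rceil>"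
  have "1 / \<delta> \<ge> 1" using d by simp
  then have rK: "real K = real_of_int \<lceil>1 / \<delta>\<rceil>" by (simp add: K_def)
  have K: "1 / \<delta> \<le> real K" "real K \<le> 1 / \<delta> + 1" "real K \<ge> 1"
    unfolding rK using \<open>1 / \<delta> \<ge> 1\<close> by linarith+
  define f where "f q = nat \<lfloor>real K * frac (real q * c)\<rfloor>" for q
  have f: "f \<in> {0..N} \<rightarrow> {..<K}"
  proof
    fix q assume "q \<in> {0..N}"
    have "real K * frac (real q * c) < real K * 1"
      using K(3) by (intro mult_strict_left_mono frac_lt_1) linarith
    moreover have "real K * frac (real q * c) \<ge> 0" by simp
    ultimately have "\<lfloor>real K * frac (real q * c)\<rfloor> < int K" by (simp add: floor_less_iff)
    then show "f q \<in> {..<K}" using K(3) by (simp add: f_def)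
  qed
  have "{..<K} \<noteq> {}" using K(3) by (simp add: lessThan_empty_iff)
  then obtain y where y: "card (f -` {y} \<inter> {0..N}) * card {..<K} \<ge> card {0..N}"
    using pigeonhole_card[OF f] by auto
  define S where "S = f -` {y} \<inter> {0..N}"
  have S: "finite S" "S \<noteq> {}" using y by (auto simp: S_def)
  define m where "m = Min S"
  have m: "m \<in> S" using S by (simp add: m_def)
  have "(\<lambda>q. q - m) ` (S - {m}) \<subseteq> {q \<in> {1..N}. near_int \<delta> (real q * c)}"
  proof (rule image_subsetI)
    fix q assume q: "q \<in> S - {m}"
    then have mq: "m < q" using S by (simp add: m_def less_le)
    have "f q = f m" using q m by (auto simp: S_def)
    then have "\<lfloor>real K * frac (real q * c)\<rfloor> = \<lfloor>real K * frac (real m * c)\<rfloor>"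
      unfolding f_def by (simp add: nat_eq_iff2)
    then have "\<bar>real K * frac (real q * c) - real K * frac (real m * c)\<bar> < 1" by linarith
    then have "\<bar>real K * (frac (real q * c) - frac (real m * c))\<bar> < 1" by (simp add: right_diff_distrib)
    then have "\<bar>frac (real q * c) - frac (real m * c)\<bar> * real K < 1"
      by (simp add: abs_mult mult.commute)
    then have "\<bar>frac (real q * c) - frac (real m * c)\<bar> < 1 / real K"
      using K(3) by (subst pos_less_divide_eq) auto
    also have "1 / real K \<le> \<delta>" using K d by (simp add: field_simps)
    finally have "\<bar>real (q - m) * c - of_int (\<lfloor>real q * c\<rfloor> - \<lfloor>real m * c\<rfloor>)\<bar> < \<delta>"
      using mq by (simp add: frac_def of_nat_diff algebra_simps)
    then have "near_int \<delta> (real (q - m) * c)" unfolding near_int_def by blast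
    moreover have "q - m \<in> {1..N}" using q mq by (auto simp: S_def)
    ultimately show "q - m \<in> {q \<in> {1..N}. near_int \<delta> (real q * c)}" by blast
  qed
  moreover have "inj_on (\<lambda>q. q - m) (S - {m})"
  proof (rule inj_onI)
    fix q q' assume "q \<in> S - {m}" "q' \<in> S - {m}" "q - m = q' - m"
    moreover have "m \<le> q" "m \<le> q'" using calculation S by (auto simp: m_def)
    ultimately show "q = q'" by simp
  qed
  ultimately have "card (S - {m}) \<le> card {q \<in> {1..N}. near_int \<delta> (real q * c)}"
    by (intro card_inj_on_le) auto
  then have "real (card S) - 1 \<le> real (card {q \<in> {1..N}. near_int \<delta> (real q * c)})"
    using m S by simp
  moreover have "real N * \<delta> / 2 \<le> real (card S)"
  proof -
    have "real (card {0..N}) \<le> real (card S * K)" using y unfolding S_def by (simp only: of_nat_le_iff card_lessThan)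
    then have "real N + 1 \<le> real (card S) * real K" by simp
    also have "\<dots> \<le> real (card S) * (2 / \<delta>)"
      using K(2) \<open>1 / \<delta> \<ge> 1\<close> by (intro mult_left_mono) auto
    finally show ?thesis using d by (simp add: field_simps)
  qed
  ultimately show ?thesis by linarith
qed

lemma abel_summation:
  fixes b w :: "nat \<Rightarrow> real"
  shows "(\<Sum>k=1..Suc N. b k * w k)
    = sum b {1..Suc N} * w (Suc N) + (\<Sum>k=1..N. sum b {1..k} * (w k - w (Suc k)))"
  by (induction N) (simp_all add: algebra_simps)

text \<open>Split a^(n+1) - b^(n+1) into a (a^n - b^n) and b^n (a - b); for n >= 1 the second part
  is at most the first. It is the discrete form of comparing x d(x^n) with d(x^(n+1)), whose ratio n
  / (n + 1) is at least 1/2.\<close>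

lemma power_diff_ge_half:
  fixes a b :: real
  assumes "0 \<le> b" "b \<le> a" "n \<ge> 1"
  shows "(a ^ Suc n - b ^ Suc n) / 2 \<le> a * (a ^ n - b ^ n)"
proof -
  obtain m where m: "n = Suc m" using assms(3) by (cases n) auto
  have "b ^ m \<le> a ^ m" using assms by (intro power_mono) auto
  then have "a * b ^ m \<le> a * a ^ m" using assms by (intro mult_left_mono) auto
  then have "a * ((a - b) * b ^ m) \<le> a * (a ^ n - b ^ n)"
    using assms by (intro mult_left_mono) (auto simp: m algebra_simps)
  moreover have "b * ((a - b) * b ^ m) \<le> a * ((a - b) * b ^ m)"
    using assms by (intro mult_right_mono) auto
  ultimately have "b ^ n * (a - b) \<le> a * (a ^ n - b ^ n)"
    by (simp add: m algebra_simps)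
  then have "a ^ Suc n - b ^ Suc n \<le> 2 * (a * (a ^ n - b ^ n))"
    by (simp add: algebra_simps)
  then show ?thesis by simp
qed

text \<open>Summation by parts turns the restricted sum into counts times decrements of
  \<open>w\<close>, where the count up to k is at least k \<psi>(k) / 2 - 1. The unrestricted sum
  becomes k times decrements of \<open>v\<close>, and \<open>power_diff_ge_half\<close> compares the
  two.\<close>

lemma not_summable_restrict_near:
  assumes psi: "approximating_function \<psi>" "\<And>q. \<psi> q \<le> 1" and n: "n \<ge> 1"
    and div: "\<not> summable (\<lambda>q. \<psi> (Suc q) ^ Suc n)"
  shows "\<not> summable (\<lambda>q. restrict_near c \<psi> (Suc q) ^ n)"
proof
  assume sum: "summable (\<lambda>q. restrict_near c \<psi> (Suc q) ^ n)"
  define T where "T = (\<Sum>q. restrict_near c \<psi> (Suc q) ^ n)"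
  define b where "b q = (if near_int (\<psi> q) (real q * c) then 1 else 0 :: real)" for q
  define w where "w q = \<psi> q ^ n" for q
  define v where "v q = \<psi> q ^ Suc n" for q
  have psi0: "\<psi> q \<ge> 0" if "q \<ge> 1" for q using psi that by (auto simp: approximating_function_def)
  have anti: "\<psi> r \<le> \<psi> q" if "q \<ge> 1" "q \<le> r" for q r using psi that by (auto simp: approximating_function_def)
  have w: "w q \<ge> 0" "w (Suc q) \<le> w q" if "q \<ge> 1" for q
    using psi0 anti that by (auto simp: w_def intro!: power_mono)
  \<comment> \<open>For q <= k, being within \<psi>(k) of an integer implies being within \<psi>(q),
    so the pigeonhole count applies with one fixed radius.\<close>
  have count: "real k * \<psi> k / 2 - 1 \<le> sum b {1..k}" if k: "k \<ge> 1" for k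
  proof (cases "\<psi> k > 0")
    case True
    have "real k * \<psi> k / 2 - 1 \<le> real (card {q \<in> {1..k}. near_int (\<psi> k) (real q * c)})"
      using True psi(2) by (rule card_near_int_ge)
    also have "\<dots> = (\<Sum>q=1..k. if near_int (\<psi> k) (real q * c) then 1 else 0)"
      by (simp add: sum.If_cases Int_def)
    also have "\<dots> \<le> sum b {1..k}"
      unfolding b_def using anti by (intro sum_mono) (auto intro: near_int_mono)
    finally show ?thesis .
  next
    case False
    then have "\<psi> k = 0" using psi0[OF k] by simp
    moreover have "sum b {1..k} \<ge> 0" unfolding b_def by (intro sum_nonneg) auto
    ultimately show ?thesis by simp
  qed
  have bw: "b q * w q = restrict_near c \<psi> q ^ n" for q
    using n by (simp add: b_def w_def restrict_near_def)
  have main: "sum v {1..Suc N} / 4 - w 1 \<le> T" for N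
  proof -
    \<comment> \<open>The losses of 1 in \<open>count\<close> add up to the single value
      \<open>w 1\<close>.\<close>
    have tele: "w (Suc N) + (\<Sum>k=1..N. w k - w (Suc k)) = w 1" for N
      by (induction N) simp_all
    have "sum v {1..Suc N} = (\<Sum>k=1..Suc N. 1 * v k)" by simp
    also have "\<dots> = real (Suc N) * v (Suc N) + (\<Sum>k=1..N. real k * (v k - v (Suc k)))"
      by (subst abel_summation) simp
    finally have v_eq: "sum v {1..Suc N} / 4 =
        real (Suc N) * v (Suc N) / 4 + (\<Sum>k=1..N. real k * (v k - v (Suc k)) / 4)"
      by (simp add: add_divide_distrib sum_divide_distrib)
    have "real (Suc N) * v (Suc N) / 4 \<le> real (Suc N) * \<psi> (Suc N) / 2 * w (Suc N)"
      using psi0[of "Suc N"] by (simp add: v_def w_def)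
    moreover have "(\<Sum>k=1..N. real k * (v k - v (Suc k)) / 4)
        \<le> (\<Sum>k=1..N. real k * \<psi> k / 2 * (w k - w (Suc k)))"
    proof (rule sum_mono)
      fix k assume k: "k \<in> {1..N}"
      have "(v k - v (Suc k)) / 2 \<le> \<psi> k * (w k - w (Suc k))"
        unfolding v_def w_def using k n psi0 anti by (intro power_diff_ge_half) auto
      then have "real k * ((v k - v (Suc k)) / 2) \<le> real k * (\<psi> k * (w k - w (Suc k)))"
        by (rule mult_left_mono) simp
      then show "real k * (v k - v (Suc k)) / 4 \<le> real k * \<psi> k / 2 * (w k - w (Suc k))"
        by simp
    qed
    ultimately have "sum v {1..Suc N} / 4 - w 1 \<le> real (Suc N) * \<psi> (Suc N) / 2 * w (Suc N)
        + (\<Sum>k=1..N. real k * \<psi> k / 2 * (w k - w (Suc k))) - (w (Suc N) + (\<Sum>k=1..N. w k - w (Suc k)))"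
      unfolding v_eq tele by linarith
    also have "\<dots> = (real (Suc N) * \<psi> (Suc N) / 2 - 1) * w (Suc N)
        + (\<Sum>k=1..N. (real k * \<psi> k / 2 - 1) * (w k - w (Suc k)))"
      by (simp add: left_diff_distrib sum_subtractf)
    \<comment> \<open>The lower bounds for the counts may be inserted termwise because the
      decrements of \<open>w\<close> are nonnegative.\<close>
    also have "\<dots> \<le> sum b {1..Suc N} * w (Suc N) + (\<Sum>k=1..N. sum b {1..k} * (w k - w (Suc k)))"
      using w by (intro add_mono sum_mono mult_right_mono count) auto
    also have "\<dots> = (\<Sum>k=1..Suc N. b k * w k)" by (rule abel_summation[symmetric])
    also have "\<dots> = (\<Sum>k<Suc N. restrict_near c \<psi> (Suc k) ^ n)"
      unfolding bw by (rule sum.reindex_bij_witness[of _ Suc "\<lambda>x. x - 1"]) auto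
    also have "\<dots> \<le> T" unfolding T_def
      by (intro sum_le_suminf[OF sum]) (auto simp: restrict_near_nonneg)
    finally show ?thesis .
  qed
  have "summable (\<lambda>q. \<psi> (Suc q) ^ Suc n)"
  proof (rule summableI_nonneg_bounded)
    fix N
    have "(\<Sum>q<N. \<psi> (Suc q) ^ Suc n) \<le> (\<Sum>q<Suc N. \<psi> (Suc q) ^ Suc n)"
      using psi0[of "Suc N"] by simp
    also have "\<dots> = sum v {1..Suc N}"
      unfolding v_def by (rule sum.reindex_bij_witness[of _ "\<lambda>x. x - 1" Suc]) auto
    also have "sum v {1..Suc N} \<le> 4 * (T + w 1)"
    proof -
      define V where "V = sum v {1..Suc N}"
      have "V / 4 - w 1 \<le> T" unfolding V_def by (rule main)
      then have "V / 4 \<le> T + w 1" by simp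
      then have "V \<le> 4 * (T + w 1)" by (simp add: field_simps)
      then show ?thesis unfolding V_def .
    qed
    finally show "(\<Sum>q<N. \<psi> (Suc q) ^ Suc n) \<le> 4 * (T + w 1)" .
  qed (use psi0 in auto)
  with div show False by simp
qed

section \<open>Lebesgue measure in coordinates\<close>

definition vec_insert :: "'n::finite \<Rightarrow> ('n \<Rightarrow> real) \<times> real \<Rightarrow> real ^ 'n" where
  "vec_insert i z = (\<chi> j. if j = i then snd z else fst z j)"

lemma measurable_vec_insert [measurable]:
  fixes i :: "'n::finite"
  shows "vec_insert i
    \<in> borel_measurable ((\<Pi>\<^sub>M j\<in>UNIV - {i}. lborel) \<Otimes>\<^sub>M lborel)"
proof (subst borel_measurable_euclidean_space, intro ballI)
  fix b :: "real ^ 'n" assume "b \<in> Basis"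
  then obtain j where b: "b = axis j 1"
    by (auto simp: Basis_vec_def)
  have "(\<lambda>z. if j = i then snd z else fst z j)
      \<in> borel_measurable ((\<Pi>\<^sub>M j\<in>UNIV - {i}. lborel) \<Otimes>\<^sub>M lborel)"
  proof (cases "j = i")
    case False
    then have "(\<lambda>y. y j) \<in> measurable (\<Pi>\<^sub>M j\<in>UNIV - {i}. lborel) (lborel :: real measure)"
      by (intro measurable_component_singleton) auto
    from measurable_compose[OF measurable_fst this] False show ?thesis by simp
  qed simp
  then show "(\<lambda>z. vec_insert i z \<bullet> b)
      \<in> borel_measurable ((\<Pi>\<^sub>M j\<in>UNIV - {i}. lborel) \<Otimes>\<^sub>M lborel)"
    by (simp add: b inner_axis vec_insert_def)
qed

lemma sets_Collect_vec [measurable]: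
  fixes A :: "'n::finite \<Rightarrow> real set"
  assumes "\<And>j. A j \<in> sets borel"
  shows "{x :: real ^ 'n. \<forall>j. x $ j \<in> A j} \<in> sets borel"
proof -
  have "{x :: real ^ 'n. x $ j \<in> A j} \<in> sets borel" for j
  proof -
    have "(\<lambda>x :: real ^ 'n. x $ j) -` A j \<inter> space borel \<in> sets borel"
      by (rule measurable_sets[OF _ assms]) (simp add: borel_measurable_continuous_onI)
    then show ?thesis by (simp add: vimage_def)
  qed
  moreover have "{x :: real ^ 'n. \<forall>j. x $ j \<in> A j} = (\<Inter>j. {x. x $ j \<in> A j})"
    by auto
  ultimately show ?thesis by auto
qed

lemma emeasure_distr_vec_insert:
  fixes i :: "'n::finite" and A :: "'n \<Rightarrow> real set"
  assumes A: "\<And>j. A j \<in> sets borel"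
  shows "emeasure (distr ((\<Pi>\<^sub>M j\<in>UNIV - {i}. lborel) \<Otimes>\<^sub>M lborel) borel
      (vec_insert i)) {x. \<forall>j. x $ j \<in> A j}
    = (\<Prod>j\<in>UNIV. emeasure lborel (A j))"
proof -
  interpret product_sigma_finite "\<lambda>_::'n. lborel :: real measure" ..
  have vec: "{x :: real ^ 'n. \<forall>j. x $ j \<in> A j} \<in> sets borel"
    by (rule sets_Collect_vec[OF A])
  have eq: "vec_insert i -` {x. \<forall>j. x $ j \<in> A j}
      \<inter> space ((\<Pi>\<^sub>M j\<in>UNIV - {i}. lborel) \<Otimes>\<^sub>M lborel) = (\<Pi>\<^sub>E j\<in>UNIV - {i}. A j) \<times> A i"
  proof (intro set_eqI iffI)
    fix z assume "z \<in> vec_insert i -` {x. \<forall>j. x $ j \<in> A j}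
      \<inter> space ((\<Pi>\<^sub>M j\<in>UNIV - {i}. lborel) \<Otimes>\<^sub>M lborel)"
    then have *: "\<And>j. (if j = i then snd z else fst z j) \<in> A j"
        "fst z \<in> space (\<Pi>\<^sub>M j\<in>UNIV - {i}. lborel)"
      by (auto simp: vec_insert_def space_pair_measure)
    have "snd z \<in> A i" using *(1)[of i] by simp
    moreover have "fst z j \<in> A j" if "j \<noteq> i" for j using *(1)[of j] that by simp
    ultimately show "z \<in> (\<Pi>\<^sub>E j\<in>UNIV - {i}. A j) \<times> A i"
      using *(2) by (cases z) (auto simp: space_PiM PiE_iff)
  next
    fix z assume "z \<in> (\<Pi>\<^sub>E j\<in>UNIV - {i}. A j) \<times> A i"
    then show "z \<in> vec_insert i -` {x. \<forall>j. x $ j \<in> A j}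
      \<inter> space ((\<Pi>\<^sub>M j\<in>UNIV - {i}. lborel) \<Otimes>\<^sub>M lborel)"
      by (cases z) (auto simp: vec_insert_def space_pair_measure space_PiM PiE_iff)
  qed
  have "emeasure (distr ((\<Pi>\<^sub>M j\<in>UNIV - {i}. lborel) \<Otimes>\<^sub>M lborel) borel
      (vec_insert i)) {x. \<forall>j. x $ j \<in> A j}
    = emeasure ((\<Pi>\<^sub>M j\<in>UNIV - {i}. lborel) \<Otimes>\<^sub>M lborel) ((\<Pi>\<^sub>E j\<in>UNIV - {i}. A j) \<times> A i)"
    by (subst emeasure_distr[OF measurable_vec_insert vec], subst eq, rule refl)
  also have "\<dots> = emeasure (\<Pi>\<^sub>M j\<in>UNIV - {i}. lborel) (\<Pi>\<^sub>E j\<in>UNIV - {i}. A j) * emeasure lborel (A i)"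
    using A by (intro lborel.emeasure_pair_measure_Times sets_PiM_I_finite) auto
  also have "\<dots> = (\<Prod>j\<in>UNIV - {i}. emeasure lborel (A j)) * emeasure lborel (A i)"
    using A by (subst emeasure_PiM) auto
  also have "\<dots> = (\<Prod>j\<in>UNIV. emeasure lborel (A j))"
    by (subst (2) prod.remove[of _ i]) (auto simp: mult.commute)
  finally show ?thesis .
qed

text \<open>Prepares Fubini in coordinate i, since the measure on the hyperplane is a product over
  the other coordinates. Boxes determine Lebesgue measure, and on them both sides are the product of
  the side lengths.\<close>

lemma lborel_vec_split:
  fixes i :: "'n::finite"
  shows "(lborel :: (real ^ 'n) measure) =
    distr ((\<Pi>\<^sub>M j\<in>UNIV - {i}. lborel) \<Otimes>\<^sub>M lborel) borel (vec_insert i)"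
proof (rule lborel_eqI)
  fix l u :: "real ^ 'n" assume le: "\<And>b. b \<in> Basis \<Longrightarrow> l \<bullet> b \<le> u \<bullet> b"
  have le': "l $ j \<le> u $ j" for j
    using le[of "axis j 1"] by (simp add: inner_axis)
  have box: "box l u = {x. \<forall>j. x $ j \<in> {l $ j <..< u $ j}}"
    by (auto simp: mem_box_cart)
  have "inj (\<lambda>j::'n. axis j (1::real))"
    by (auto simp: inj_on_def axis_eq_axis)
  moreover have "(Basis :: (real ^ 'n) set) = range (\<lambda>j. axis j 1)"
    by (auto simp: Basis_vec_def)
  ultimately have "(\<Prod>b\<in>Basis. (u - l) \<bullet> b) = (\<Prod>j\<in>UNIV. (u - l) \<bullet> axis j 1)"
    by (metis (no_types, lifting) prod.reindex_cong)
  then have "(\<Prod>b\<in>Basis. (u - l) \<bullet> b) = (\<Prod>j\<in>UNIV. u $ j - l $ j)"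
    by (simp add: inner_axis)
  then show "emeasure (distr ((\<Pi>\<^sub>M j\<in>UNIV - {i}. lborel) \<Otimes>\<^sub>M lborel) borel
      (vec_insert i)) (box l u) = ennreal (\<Prod>b\<in>Basis. (u - l) \<bullet> b)"
    unfolding box by (subst emeasure_distr_vec_insert) (simp_all add: le' prod_ennreal)
qed simp

lemma emeasure_lborel_vec:
  fixes A :: "'n::finite \<Rightarrow> real set"
  assumes "\<And>j. A j \<in> sets borel"
  shows "emeasure lborel {x :: real ^ 'n. \<forall>j. x $ j \<in> A j} = (\<Prod>j\<in>UNIV. emeasure lborel (A j))"
  by (subst lborel_vec_split[of undefined]) (rule emeasure_distr_vec_insert[OF assms])

text \<open>The substituted predicate ignores x_i, so its exceptional set is a cylinder over the
  exceptional set of the hyperplane, and by Fubini a null cylinder has a null base. This is why the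
  metric theorems can be stated on all of \<open>real ^ 'n\<close>.\<close>

lemma AE_hyperplane_lborelI:
  fixes i :: "'n::finite"
  assumes P: "{x. P x} \<in> sets borel"
    and ae: "AE x :: real ^ 'n in lborel. P (\<chi> j. if j = i then c else x $ j)"
  shows "AE x in hyperplane_lborel i c. P x"
proof -
  let ?M = "\<Pi>\<^sub>M j\<in>UNIV - {i}. (lborel :: real measure)"
  interpret product_sigma_finite "\<lambda>_::'n. lborel :: real measure" ..
  interpret M: sigma_finite_measure ?M
    by (rule sigma_finite) simp
  interpret pair_sigma_finite ?M "lborel :: real measure" ..
  have m: "(\<lambda>x :: real ^ 'n. \<chi> j. if j = i then c else x $ j) \<in> borel_measurable borel"
  proof (intro borel_measurable_continuous_onI continuous_intros)
    show "continuous_on UNIV (\<lambda>x :: real ^ 'n. if j = i then c else x $ j)" for j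
      by (cases "j = i") (auto intro!: continuous_intros)
  qed
  have P': "{x :: real ^ 'n. P (\<chi> j. if j = i then c else x $ j)} \<in> sets borel"
    using measurable_sets[OF m P] by (simp add: vimage_def)
  have eq: "(\<chi> j. if j = i then c else vec_insert i z $ j) = hyperplane_embed i c (fst z)" for z
    by (simp add: vec_insert_def hyperplane_embed_def vec_eq_iff)
  have "AE x in distr (?M \<Otimes>\<^sub>M (lborel :: real measure)) borel (vec_insert i). P (\<chi> j. if j = i then c else x $ j)"
    using ae by (subst lborel_vec_split[of i, symmetric])
  then have "AE z in ?M \<Otimes>\<^sub>M (lborel :: real measure). P (\<chi> j. if j = i then c else vec_insert i z $ j)"
    by (subst (asm) AE_distr_iff) (use P' in auto)
  then have "AE z in ?M \<Otimes>\<^sub>M (lborel :: real measure). P (hyperplane_embed i c (fst z))"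
    unfolding eq .
  then have "AE y in ?M. AE t in (lborel :: real measure). P (hyperplane_embed i c (fst (y, t)))"
    by (rule AE_pair)
  then have "AE y in ?M. P (hyperplane_embed i c y)"
  proof (rule AE_mp, intro AE_I2 impI)
    fix y assume *: "AE t in (lborel :: real measure). P (hyperplane_embed i c (fst (y, t)))"
    show "P (hyperplane_embed i c y)"
    \<comment> \<open>A predicate that does not depend on t can fail only on the whole line, which
      is not null.\<close>
    proof (rule ccontr)
      assume "\<not> P (hyperplane_embed i c y)"
      with * have "AE t in (lborel :: real measure). False" by simp
      then show False by (simp add: AE_iff_measurable[OF _ refl] ennreal_top_neq_zero)
    qed
  qed
  moreover have "{x \<in> space (restrict_space borel (coord_hyperplane i c)). P x}
      \<in> sets (restrict_space borel (coord_hyperplane i c))"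
    using P by (auto simp: sets_restrict_space space_restrict_space)
  ultimately show ?thesis
    unfolding hyperplane_lborel_def by (subst AE_distr_iff) auto
qed

section \<open>Dyadic cubes and density\<close>

text \<open>The floor makes the cubes half-open, so those of one level partition the space, and
  multiplication by 2^k carries level k to level 0 with the same label.\<close>

definition dyadic_cube :: "nat \<Rightarrow> int ^ 'n::finite \<Rightarrow> (real ^ 'n) set" where
  "dyadic_cube k \<alpha> = {x. \<forall>j. \<lfloor>2 ^ k * x $ j\<rfloor> = \<alpha> $ j}"

lemma dyadic_cube_eq:
  "dyadic_cube k \<alpha> = {x. \<forall>j. x $ j \<in> {real_of_int (\<alpha> $ j) / 2 ^ k ..< (real_of_int (\<alpha> $ j) + 1) / 2 ^ k}}"
  by (auto simp: dyadic_cube_def floor_eq_iff field_simps)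

lemma sets_dyadic_cube [measurable]: "dyadic_cube k \<alpha> \<in> sets borel"
  unfolding dyadic_cube_eq by (rule sets_Collect_vec) simp

lemma emeasure_dyadic_cube:
  "emeasure lborel (dyadic_cube k (\<alpha> :: int ^ 'n::finite)) = ennreal ((1 / 2 ^ k) ^ CARD('n))"
proof -
  have "emeasure lborel (dyadic_cube k \<alpha>) = (\<Prod>j\<in>(UNIV :: 'n set). ennreal (1 / 2 ^ k))"
    unfolding dyadic_cube_eq
  proof (subst emeasure_lborel_vec, goal_cases)
    case 2
    have "emeasure lborel {real_of_int a / 2 ^ k ..< (real_of_int a + 1) / 2 ^ k} = ennreal (1 / 2 ^ k)" for a
      by (subst emeasure_lborel_Ico) (simp_all add: divide_right_mono diff_divide_distrib[symmetric])
    then show ?case by simp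
  qed simp
  then show ?thesis by (simp add: ennreal_power)
qed

lemma dyadic_cube_dist:
  fixes x y :: "real ^ 'n::finite"
  assumes "x \<in> dyadic_cube k \<alpha>" "y \<in> dyadic_cube k \<alpha>"
  shows "dist x y \<le> CARD('n) / 2 ^ k"
proof -
  have "\<bar>x $ j - y $ j\<bar> \<le> 1 / 2 ^ k" for j
  proof -
    have "\<bar>2 ^ k * x $ j - 2 ^ k * y $ j\<bar> \<le> 1"
    proof -
      have "\<lfloor>2 ^ k * x $ j\<rfloor> = \<lfloor>2 ^ k * y $ j\<rfloor>"
        using assms by (simp add: dyadic_cube_def)
      then show ?thesis by linarith
    qed
    then have "\<bar>2 ^ k * (x $ j - y $ j)\<bar> \<le> 1" by (simp add: algebra_simps)
    then have "2 ^ k * \<bar>x $ j - y $ j\<bar> \<le> 1" by (simp add: abs_mult)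
    then show ?thesis by (simp add: field_simps)
  qed
  then have "(\<Sum>j\<in>UNIV. \<bar>(x - y) $ j\<bar>) \<le> (\<Sum>j\<in>(UNIV :: 'n set). 1 / 2 ^ k)"
    by (intro sum_mono) simp
  then show ?thesis
    using norm_le_l1_cart[of "x - y"] by (simp add: dist_norm)
qed

text \<open>A weak density theorem. An open V around A with |V| <= (1 + e) |A| satisfies (1 - e) |V|
  <= (1 - e^2) |A| < |A|. If A had density at most 1 - e in every dyadic cube, adding up the cubes
  of a fine level inside V would contradict this.\<close>

lemma exists_dense_dyadic_cube:
  fixes A :: "(real ^ 'n::finite) set"
  assumes A: "A \<in> sets borel" "0 < emeasure lborel A" "emeasure lborel A < \<infinity>"
    and eps: "0 < e" "e < 1"
  shows "\<exists>k \<alpha>. emeasure lborel (A \<inter> dyadic_cube k \<alpha>) > ennreal (1 - e) * emeasure lborel (dyadic_cube k \<alpha> :: (real ^ 'n) set)"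
proof -
  define a where "a = measure lborel A"
  have "emeasure lborel A \<noteq> top" using A(3) by simp
  then have ea: "emeasure lborel A = ennreal a"
    unfolding a_def by (rule emeasure_eq_ennreal_measure)
  have "a > 0" using A(2) unfolding ea by simp
  note a = ea this
  have "A \<in> sets lebesgue" using A(1) by simp
  moreover have "e * a > 0" using a(2) eps(1) by simp
  ultimately obtain V where V: "open V" "A \<subseteq> V" "V - A \<in> lmeasurable"
      "emeasure lebesgue (V - A) < ennreal (e * a)"
    by (rule sets_lebesgue_outer_open)
  have [measurable]: "V \<in> sets borel" "A \<in> sets borel" using V(1) A(1) by auto
  have "emeasure lborel V = emeasure lborel A + emeasure lborel (V - A)"
    using V(2) by (subst plus_emeasure) (auto simp: Un_absorb1)
  also have "\<dots> \<le> ennreal a + ennreal (e * a)"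
    using V(4) a by (intro add_mono) (auto simp: less_imp_le)
  also have "\<dots> = ennreal (a + e * a)"
    using a eps by simp
  finally have mV: "emeasure lborel V \<le> ennreal (a + e * a)" .
  have "ennreal (1 - e) * emeasure lborel V \<le> ennreal (1 - e) * ennreal (a + e * a)"
    using mV by (intro mult_left_mono) auto
  also have "\<dots> = ennreal (a - e * e * a)"
  proof -
    have "ennreal (1 - e) * ennreal (a + e * a) = ennreal ((1 - e) * (a + e * a))"
      using eps a by (subst ennreal_mult) auto
    then show ?thesis by (simp add: algebra_simps)
  qed
  also have "\<dots> < emeasure lborel A"
  proof -
    have "e * e * a > 0" using eps a by simp
    moreover have "e * e < 1" using mult_strict_mono[of e 1 e 1] eps by simp
    then have "a - e * e * a > 0" using a(2) by simp
    ultimately show ?thesis unfolding a(1) using a(2) by (intro ennreal_lessI) auto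
  qed
  finally have less: "ennreal (1 - e) * emeasure lborel V < emeasure lborel A" .
  \<comment> \<open>The unions \<open>U k\<close> of level-k cubes inside V increase to V, so at
    some level the part of A they contain exceeds (1 - e) |V|.\<close>
  define J where "J k = {\<alpha>. dyadic_cube k \<alpha> \<subseteq> V}" for k
  define U where "U k = (\<Union>\<alpha>\<in>J k. dyadic_cube k \<alpha>)" for k
  have [measurable]: "U k \<in> sets borel" for k
    unfolding U_def by (intro sets.countable_UN'') auto
  have UV: "U k \<subseteq> V" for k by (auto simp: U_def J_def)
  have x_U: "x \<in> U k" if "dyadic_cube k (\<chi> j. \<lfloor>2 ^ k * x $ j\<rfloor>) \<subseteq> V" for x k
  proof -
    have "x \<in> dyadic_cube k (\<chi> j. \<lfloor>2 ^ k * x $ j\<rfloor>)" by (simp add: dyadic_cube_def)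
    with that show ?thesis unfolding U_def J_def by blast
  qed
  have "incseq U"
  proof (rule incseq_SucI, rule subsetI)
    fix k x assume "x \<in> U k"
    then obtain \<alpha> where al: "dyadic_cube k \<alpha> \<subseteq> V" "x \<in> dyadic_cube k \<alpha>"
      by (auto simp: U_def J_def)
    have "dyadic_cube (Suc k) (\<chi> j. \<lfloor>2 ^ Suc k * x $ j\<rfloor>) \<subseteq> dyadic_cube k \<alpha>"
    proof
      fix y assume "y \<in> dyadic_cube (Suc k) (\<chi> j. \<lfloor>2 ^ Suc k * x $ j\<rfloor>)"
      then have y: "\<lfloor>2 * (2 ^ k * y $ j)\<rfloor> = \<lfloor>2 * (2 ^ k * x $ j)\<rfloor>" for j
        by (simp add: dyadic_cube_def mult.assoc)
      have "\<lfloor>2 ^ k * y $ j\<rfloor> = \<lfloor>2 ^ k * x $ j\<rfloor>" for j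
      proof -
        \<comment> \<open>Passing to the parent cube halves the label, rounding down.\<close>
        have half: "\<lfloor>t\<rfloor> = \<lfloor>2 * t\<rfloor> div 2" for t :: real
          using floor_divide_real_eq_div[of 2 "2 * t"] by simp
        show ?thesis by (subst (1 2) half) (simp add: y)
      qed
      then show "y \<in> dyadic_cube k \<alpha>" using al(2) by (simp add: dyadic_cube_def)
    qed
    with al show "x \<in> U (Suc k)" by (intro x_U) auto
  qed
  have "(\<Union>k. U k) = V"
  proof (intro equalityI subsetI)
    fix x assume "x \<in> V"
    then obtain d where d: "d > 0" "ball x d \<subseteq> V" using V(1) openE by blast
    obtain k where k: "CARD('n) / d < 2 ^ k"
      using real_arch_pow[of 2 "CARD('n) / d"] by (auto simp del: divide_less_eq)
    have "dyadic_cube k (\<chi> j. \<lfloor>2 ^ k * x $ j\<rfloor>) \<subseteq> ball x d"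
    proof
      fix y assume y: "y \<in> dyadic_cube k (\<chi> j. \<lfloor>2 ^ k * x $ j\<rfloor>)"
      have "dist x y \<le> CARD('n) / 2 ^ k"
        by (rule dyadic_cube_dist[OF _ y]) (simp add: dyadic_cube_def)
      also have "\<dots> < d" using k d(1) by (simp add: field_simps)
      finally show "y \<in> ball x d" by simp
    qed
    then have "x \<in> U k" by (intro x_U subset_trans[OF _ d(2)])
    then show "x \<in> (\<Union>k. U k)" by (rule UN_I[OF UNIV_I])
  next
    fix x assume "x \<in> (\<Union>k. U k)"
    then show "x \<in> V" using UV by blast
  qed
  then have "(\<Union>k. A \<inter> U k) = A" using V(2) by auto
  moreover have "(\<lambda>k. emeasure lborel (A \<inter> U k)) \<longlonglongrightarrow> emeasure lborel (\<Union>k. A \<inter> U k)"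
  proof (rule Lim_emeasure_incseq)
    show "range (\<lambda>k. A \<inter> U k) \<subseteq> sets lborel" by auto
    show "incseq (\<lambda>k. A \<inter> U k)"
      using \<open>incseq U\<close> unfolding incseq_def by blast
  qed
  ultimately have "(\<lambda>k. emeasure lborel (A \<inter> U k)) \<longlonglongrightarrow> emeasure lborel A"
    by simp
  from order_tendstoD(1)[OF this less] obtain k
    where k: "ennreal (1 - e) * emeasure lborel V < emeasure lborel (A \<inter> U k)"
    by (auto simp: eventually_sequentially)
  show ?thesis
  proof (rule ccontr)
    assume "\<not> ?thesis"
    then have le: "emeasure lborel (A \<inter> dyadic_cube k \<alpha>) \<le> ennreal (1 - e) * emeasure lborel (dyadic_cube k \<alpha>)" for \<alpha> :: "int ^ 'n"
      by (auto simp: not_less)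
    have disj: "disjoint_family_on (\<lambda>\<alpha>. dyadic_cube k \<alpha> :: (real ^ 'n) set) (J k)"
      by (auto simp: disjoint_family_on_def dyadic_cube_def vec_eq_iff)
    have "emeasure lborel (A \<inter> U k) = emeasure lborel (\<Union>\<alpha>\<in>J k. A \<inter> dyadic_cube k \<alpha>)"
      by (simp add: U_def)
    also have "\<dots> = (\<integral>\<^sup>+\<alpha>. emeasure lborel (A \<inter> dyadic_cube k \<alpha>) \<partial>count_space (J k))"
      using disj by (intro emeasure_UN_countable) (auto simp: disjoint_family_on_def)
    also have "\<dots> \<le> (\<integral>\<^sup>+\<alpha>. ennreal (1 - e) * emeasure lborel (dyadic_cube k \<alpha> :: (real ^ 'n) set) \<partial>count_space (J k))"
      by (intro nn_integral_mono le)
    also have "\<dots> = ennreal (1 - e) * (\<integral>\<^sup>+\<alpha>. emeasure lborel (dyadic_cube k \<alpha> :: (real ^ 'n) set) \<partial>count_space (J k))"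
      by (rule nn_integral_cmult) simp
    also have "(\<integral>\<^sup>+\<alpha>. emeasure lborel (dyadic_cube k \<alpha> :: (real ^ 'n) set) \<partial>count_space (J k)) = emeasure lborel (U k)"
      unfolding U_def using disj by (intro emeasure_UN_countable[symmetric]) auto
    also have "ennreal (1 - e) * emeasure lborel (U k) \<le> ennreal (1 - e) * emeasure lborel V"
      using UV by (intro mult_left_mono emeasure_mono) auto
    finally show False using k by simp
  qed
qed

section \<open>Cubes around reduced rational vectors\<close>

text \<open>The summands from e = 3 on telescope through 1 / (e - 1) - 1 / e. Keeping the first one
  exact gives a constant below 1, which is what counting reduced vectors requires.\<close>

lemma sum_inverse_squares_le:
  assumes "m \<ge> 2"
  shows "(\<Sum>e=2..m. 1 / (real e)\<^sup>2) \<le> 3/4 - 1 / real m"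
  using assms
proof (induction m rule: dec_induct)
  case (step m)
  have "1 / (real (Suc m))\<^sup>2 \<le> 1 / (real m * real (Suc m))"
    using step.hyps unfolding power2_eq_square by (intro divide_left_mono mult_right_mono mult_pos_pos) auto
  also have "\<dots> = 1 / real m - 1 / real (Suc m)"
    using step.hyps by (simp add: field_simps)
  finally have "1 / (real (Suc m))\<^sup>2 \<le> 1 / real m - 1 / real (Suc m)" .
  with step show ?case by simp
qed simp

lemma card_multiples_below:
  assumes "e dvd q" "e \<ge> 1"
  shows "card {a. a < q \<and> e dvd a} = q div (e::nat)"
proof -
  have "{a. a < q \<and> e dvd a} = (\<lambda>k. e * k) ` {..<q div e}"
    using assms by (auto simp: image_iff elim!: dvdE)
  moreover have "inj_on (\<lambda>k. e * k) {..<q div e}" using assms by (auto simp: inj_on_def)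
  ultimately show ?thesis by (simp add: card_image)
qed

text \<open>Numerators of vectors p / q in lowest terms: a factor of q is forbidden only if it
  divides all coordinates.\<close>

definition reduced_points :: "'i set \<Rightarrow> nat \<Rightarrow> ('i \<Rightarrow> nat) set" where
  "reduced_points I q = {p \<in> I \<rightarrow>\<^sub>E {..<q}. \<forall>e. e dvd q \<and> (\<forall>j\<in>I. e dvd p j) \<longrightarrow> e = 1}"

lemma finite_reduced_points: "finite I \<Longrightarrow> finite (reduced_points I q)"
  unfolding reduced_points_def by (rule finite_subset[of _ "I \<rightarrow>\<^sub>E {..<q}"]) (auto intro: finite_PiE)

text \<open>Union bound over the common divisor e >= 2: with n = \<open>card I\<close>, the vectors
  divisible by e number (q / e)^n, and n >= 2 makes their sum at most 3/4 q^n.\<close>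

lemma card_reduced_points_ge:
  assumes I: "finite I" "card I \<ge> 2" and q: "q \<ge> 1"
  shows "real q ^ card I / 4 \<le> real (card (reduced_points I q))"
proof -
  define E where "E = {e \<in> {2..q}. e dvd q}"
  define B where "B e = I \<rightarrow>\<^sub>E {a. a < q \<and> e dvd a}" for e
  have B: "finite (B e)" for e unfolding B_def using I by (intro finite_PiE) auto
  have "I \<rightarrow>\<^sub>E {..<q} \<subseteq> reduced_points I q \<union> (\<Union>e\<in>E. B e)"
  proof
    fix p assume p: "p \<in> I \<rightarrow>\<^sub>E {..<q}"
    show "p \<in> reduced_points I q \<union> (\<Union>e\<in>E. B e)"
    proof (cases "p \<in> reduced_points I q")
      case False
      then obtain e where e: "e dvd q" "\<forall>j\<in>I. e dvd p j" "e \<noteq> 1"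
        using p by (auto simp: reduced_points_def)
      then have "e \<in> E" using q dvd_imp_le[of e q] by (cases "e = 0") (auto simp: E_def)
      moreover have "p \<in> B e" using p e by (auto simp: B_def PiE_iff)
      ultimately show ?thesis by blast
    qed simp
  qed
  then have "card (I \<rightarrow>\<^sub>E {..<q}) \<le> card (reduced_points I q \<union> (\<Union>e\<in>E. B e))"
    using I B by (intro card_mono finite_UnI finite_reduced_points finite_UN_I) (auto simp: E_def)
  also have "\<dots> \<le> card (reduced_points I q) + card (\<Union>e\<in>E. B e)" by (rule card_Un_le)
  also have "card (\<Union>e\<in>E. B e) \<le> (\<Sum>e\<in>E. card (B e))" by (rule card_UN_le) (simp add: E_def)
  finally have "card (I \<rightarrow>\<^sub>E {..<q}) \<le> card (reduced_points I q) + (\<Sum>e\<in>E. card (B e))" by simp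
  then have "real (q ^ card I) \<le> real (card (reduced_points I q)) + (\<Sum>e\<in>E. real (card (B e)))"
    using I by (simp add: card_PiE flip: of_nat_sum of_nat_add of_nat_power)
  also have "(\<Sum>e\<in>E. real (card (B e))) \<le> (\<Sum>e\<in>E. real q ^ card I * (1 / (real e)\<^sup>2))"
  proof (rule sum_mono)
    fix e assume e: "e \<in> E"
    then have "card (B e) = (q div e) ^ card I"
      unfolding B_def using I by (subst card_PiE) (auto simp: E_def card_multiples_below)
    then have "real (card (B e)) = (real q / real e) ^ card I"
      using e by (simp add: E_def real_of_nat_div)
    also have "\<dots> = real q ^ card I * (1 / real e) ^ card I"
      by (simp add: power_divide)
    also have "\<dots> \<le> real q ^ card I * (1 / real e) ^ 2"
      using I e by (intro mult_left_mono power_decreasing) (auto simp: E_def)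
    finally show "real (card (B e)) \<le> real q ^ card I * (1 / (real e)\<^sup>2)"
      by (simp add: power_divide)
  qed
  also have "\<dots> \<le> (\<Sum>e=2..q. real q ^ card I * (1 / (real e)\<^sup>2))"
    by (intro sum_mono2) (auto simp: E_def)
  also have "\<dots> = real q ^ card I * (\<Sum>e=2..q. 1 / (real e)\<^sup>2)"
    by (simp add: sum_distrib_left)
  also have "\<dots> \<le> real q ^ card I * (3/4)"
  proof (rule mult_left_mono)
    show "(\<Sum>e=2..q. 1 / (real e)\<^sup>2) \<le> 3/4"
    proof (cases "q \<ge> 2")
      case True
      then show ?thesis using sum_inverse_squares_le[OF True] by (smt (verit) divide_nonneg_nonneg of_nat_0_le_iff)
    qed (use q in auto)
  qed simp
  finally show ?thesis by simp
qed

text \<open>A rational vector has only one denominator in lowest terms: if p / q = s / r, then q /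
  gcd q r divides q and all numerators of the first vector, so it is 1, and likewise for r.\<close>

lemma reduced_points_distinct:
  assumes q: "q \<ge> 1" and qr: "q \<noteq> r" and p: "p \<in> reduced_points I q" and s: "s \<in> reduced_points I r"
  shows "\<exists>j\<in>I. p j * r \<noteq> s j * q"
proof (rule ccontr)
  assume "\<not> ?thesis"
  then have eq: "p j * r = s j * q" if "j \<in> I" for j using that by blast
  define g where "g = gcd q r"
  define q' where "q' = q div g"
  define r' where "r' = r div g"
  have g: "g > 0" using q by (simp add: g_def)
  have qr': "q = g * q'" "r = g * r'" by (simp_all add: g_def q'_def r'_def)
  have cop: "coprime q' r'"
    unfolding q'_def r'_def g_def using q by (intro div_gcd_coprime) simp
  have eq': "p j * r' = s j * q'" if "j \<in> I" for j
    using eq[OF that] g unfolding qr' by simp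
  have "q' dvd p j" if "j \<in> I" for j
  proof -
    have "q' dvd p j * r'" using eq'[OF that] by simp
    then show ?thesis using cop by (simp add: coprime_dvd_mult_left_iff)
  qed
  moreover have "q' dvd q" by (simp add: qr'(1))
  ultimately have "q' = 1" using p unfolding reduced_points_def by blast
  have "r' dvd s j" if "j \<in> I" for j
  proof -
    have "r' dvd s j * q'" using eq'[OF that] by (metis dvd_triv_right)
    then show ?thesis using cop by (simp add: coprime_dvd_mult_left_iff coprime_commute)
  qed
  moreover have "r' dvd r" by (simp add: qr'(2))
  ultimately have "r' = 1" using s unfolding reduced_points_def by blast
  with \<open>q' = 1\<close> qr qr' show False by simp
qed

text \<open>With g = gcd q r, the difference a r - b q is g k with |k| < X / g, and k determines a
  modulo q / g, which leaves at most g choices. The count (2 X / g + 1) g is at most 3 X since X >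
  g; this hypothesis pays for the solutions with k = 0.\<close>

lemma card_close_pairs:
  fixes q r :: nat
  assumes q: "q \<ge> 1" "r \<ge> 1" and X: "X > real (gcd q r)"
  shows "finite {(a, b). a < q \<and> b < r \<and> \<bar>real a * real r - real b * real q\<bar> < X}"
    and "real (card {(a, b). a < q \<and> b < r \<and> \<bar>real a * real r - real b * real q\<bar> < X}) \<le> 3 * X"
proof -
  let ?C = "{(a, b). a < q \<and> b < r \<and> \<bar>real a * real r - real b * real q\<bar> < X}"
  show "finite ?C" by (rule finite_subset[of _ "{..<q} \<times> {..<r}"]) auto
  define g where "g = gcd q r"
  define q' where "q' = q div g"
  define r' where "r' = r div g"
  have g: "g > 0" using q by (simp add: g_def)
  have qr: "q = g * q'" "r = g * r'" by (simp_all add: g_def q'_def r'_def)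
  have cop: "coprime q' r'"
    unfolding q'_def r'_def g_def using q by (intro div_gcd_coprime) simp
  have q'0: "q' > 0" "r' > 0" using q qr by (auto intro: Nat.gr0I)
  define K where "K = \<lfloor>X / real g\<rfloor>"
  define f where "f = (\<lambda>(a, b). (int a * int r' - int b * int q', a div q'))"
  have "inj_on f ?C"
  proof (rule inj_onI, clarify)
    fix a b a' b' assume "f (a, b) = f (a', b')"
    then have 1: "int a * int r' - int b * int q' = int a' * int r' - int b' * int q'"
      and 2: "a div q' = a' div q'" by (auto simp: f_def)
    have "(int a - int a') * int r' = (int b - int b') * int q'"
      using 1 by (simp add: algebra_simps)
    then have "int q' dvd (int a - int a') * int r'" by simp
    moreover have "coprime (int q') (int r')" using cop by simp
    ultimately have "int q' dvd int a - int a'"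
      by (simp add: coprime_dvd_mult_left_iff)
    then have "int a mod int q' = int a' mod int q'"
      by (simp add: mod_eq_dvd_iff)
    then have 3: "a mod q' = a' mod q'"
      by (simp flip: zmod_int)
    have "a = a div q' * q' + a mod q'" by (rule div_mult_mod_eq[symmetric])
    also have "\<dots> = a' div q' * q' + a' mod q'" by (simp only: 2 3)
    also have "\<dots> = a'" by (rule div_mult_mod_eq)
    finally have "a = a'" .
    with 1 q'0 show "a = a' \<and> b = b'" by simp
  qed
  moreover have "f ` ?C \<subseteq> {- K..K} \<times> {..<g}"
  proof (rule image_subsetI)
    fix z assume "z \<in> ?C"
    then obtain a b where z: "z = (a, b)" and
      ab: "a < q" "b < r" "\<bar>real a * real r - real b * real q\<bar> < X" by blast
    define k where "k = int a * int r' - int b * int q'"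
    have "real a * real r - real b * real q = real g * real_of_int k"
      by (simp add: k_def qr algebra_simps)
    with ab(3) g have "real g * \<bar>real_of_int k\<bar> < X" by (simp add: abs_mult)
    then have "\<bar>real_of_int k\<bar> < X / real g" using g by (simp add: field_simps)
    then have "k \<in> {- K..K}" unfolding K_def by (simp, linarith)
    moreover have "a div q' < g" using ab(1) qr(1) by (simp add: less_mult_imp_div_less)
    ultimately show "f z \<in> {- K..K} \<times> {..<g}" by (simp add: f_def k_def z)
  qed
  ultimately have "card ?C \<le> card ({- K..K} \<times> {..<g})" by (intro card_inj_on_le) auto
  also have "\<dots> = nat (K - (- K) + 1) * g"
    by (simp only: card_cartesian_product card_atLeastAtMost_int card_lessThan)
  finally have "card ?C \<le> nat (2 * K + 1) * g" by simp
  from of_nat_mono[OF this] have "real (card ?C) \<le> real (nat (2 * K + 1)) * real g"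
    by (simp only: of_nat_mult)
  also have "\<dots> \<le> 3 * (X / real g) * real g"
  proof (rule mult_right_mono)
    have 1: "X / real g > 1" using X g by (simp add: g_def field_simps)
    then have "real (nat (2 * K + 1)) = 2 * real_of_int K + 1" unfolding K_def by simp
    also have "\<dots> \<le> 2 * (X / real g) + 1" unfolding K_def by linarith
    finally show "real (nat (2 * K + 1)) \<le> 3 * (X / real g)" using 1 by linarith
  qed simp
  finally show "real (card ?C) \<le> 3 * X" using g by simp
qed

section \<open>Measure and overlap of rational cubes\<close>

text \<open>Coordinates outside \<open>I\<close> range over [0, 1), a factor of measure 1, so the
  measure is that of a cube in the coordinates of \<open>I\<close> alone.\<close>

definition rational_cube :: "'n set \<Rightarrow> nat \<Rightarrow> real \<Rightarrow> ('n \<Rightarrow> nat) \<Rightarrow> (real ^ 'n::finite) set" where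
  "rational_cube I q \<delta> p =
    {x. \<forall>j. x $ j \<in> (if j \<in> I then {(real (p j) - \<delta>) / real q<..<(real (p j) + \<delta>) / real q} else {0..<1})}"

lemma rational_cube_iff:
  assumes "q \<ge> 1"
  shows "x \<in> rational_cube I q \<delta> p \<longleftrightarrow>
    (\<forall>j\<in>I. \<bar>real q * x $ j - real (p j)\<bar> < \<delta>) \<and> (\<forall>j. j \<notin> I \<longrightarrow> 0 \<le> x $ j \<and> x $ j < 1)"
proof -
  have "x $ j \<in> {(real (p j) - \<delta>) / real q<..<(real (p j) + \<delta>) / real q} \<longleftrightarrow>
      \<bar>real q * x $ j - real (p j)\<bar> < \<delta>" for j
    using assms by (auto simp: field_simps abs_less_iff)
  then show ?thesis unfolding rational_cube_def by (auto split: if_splits)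
qed

lemma emeasure_lborel_vec':
  fixes A :: "'n::finite \<Rightarrow> real set"
  assumes "\<And>j. A j \<in> sets borel" "\<And>j. emeasure lborel (A j) = ennreal (m j)" "\<And>j. m j \<ge> 0"
  shows "emeasure lborel {x :: real ^ 'n. \<forall>j. x $ j \<in> A j} = ennreal (\<Prod>j\<in>UNIV. m j)"
  using assms by (simp add: emeasure_lborel_vec prod_ennreal)

lemma emeasure_rational_cube:
  assumes "q \<ge> 1" "\<delta> \<ge> 0"
  shows "emeasure lborel (rational_cube I q \<delta> p :: (real ^ 'n::finite) set) = ennreal ((2 * \<delta> / real q) ^ card I)"
proof -
  have "emeasure lborel (rational_cube I q \<delta> p) = ennreal (\<Prod>j\<in>UNIV. if j \<in> I then 2 * \<delta> / real q else 1)"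
    unfolding rational_cube_def
  proof (rule emeasure_lborel_vec')
    fix j
    have "(real (p j) - \<delta>) / real q \<le> (real (p j) + \<delta>) / real q"
      using assms by (intro divide_right_mono) auto
    moreover have "(real (p j) + \<delta>) / real q - (real (p j) - \<delta>) / real q = 2 * \<delta> / real q"
      by (simp add: diff_divide_distrib[symmetric])
    ultimately show "emeasure lborel (if j \<in> I then {(real (p j) - \<delta>) / real q<..<(real (p j) + \<delta>) / real q} else {0..<1})
      = ennreal (if j \<in> I then 2 * \<delta> / real q else 1)"
      by simp
  qed (use assms in auto)
  then show ?thesis by (simp add: prod.If_cases)
qed

lemma sets_rational_cube [measurable]: "rational_cube I q \<delta> p \<in> sets borel"
  unfolding rational_cube_def by (rule sets_Collect_vec) simp

definition rational_cubes :: "'n set \<Rightarrow> nat \<Rightarrow> real \<Rightarrow> (real ^ 'n::finite) set" where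
  "rational_cubes I q \<delta> = (\<Union>p\<in>reduced_points I q. rational_cube I q \<delta> p)"

lemma sets_rational_cubes [measurable]: "rational_cubes I q \<delta> \<in> sets borel"
  unfolding rational_cubes_def using finite_reduced_points[of I q] by (intro sets.finite_UN) auto

text \<open>For \<delta> <= 1/2 the cubes with one denominator are disjoint; at least q^n / 4 of
  them have measure (2 \<delta> / q)^n each, and 2^n absorbs the 1/4 because n >= 2.\<close>

lemma measure_rational_cubes_ge:
  fixes I :: "'n::finite set"
  assumes I: "card I \<ge> 2" and q: "q \<ge> 1" and d: "0 \<le> \<delta>" "\<delta> \<le> 1/2"
  shows "measure lborel (rational_cubes I q \<delta>) \<ge> \<delta> ^ card I"
proof -
  have m: "measure lborel (rational_cube I q \<delta> p :: (real ^ 'n) set) = (2 * \<delta> / real q) ^ card I" for p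
    using emeasure_rational_cube[OF q d(1), of I p] d by (simp add: measure_def)
  have "disjoint_family_on (\<lambda>p. rational_cube I q \<delta> p :: (real ^ 'n) set) (reduced_points I q)"
  proof (unfold disjoint_family_on_def, intro ballI impI, rule ccontr)
    fix p s assume ps: "p \<in> reduced_points I q" "s \<in> reduced_points I q" "p \<noteq> s"
      "rational_cube I q \<delta> p \<inter> rational_cube I q \<delta> s \<noteq> ({} :: (real ^ 'n) set)"
    then obtain x :: "real ^ 'n" where x: "x \<in> rational_cube I q \<delta> p" "x \<in> rational_cube I q \<delta> s" by blast
    have "p j = s j" if "j \<in> I" for j
    proof -
      have "\<bar>real q * x $ j - real (p j)\<bar> < \<delta>" "\<bar>real q * x $ j - real (s j)\<bar> < \<delta>"
        using x that by (auto simp: rational_cube_iff[OF q])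
      then have "\<bar>real (p j) - real (s j)\<bar> < 1" using d by linarith
      then show ?thesis by linarith
    qed
    with ps show False by (auto simp: reduced_points_def intro: PiE_ext)
  qed
  then have "measure lborel (rational_cubes I q \<delta>) = (\<Sum>p\<in>reduced_points I q. measure lborel (rational_cube I q \<delta> p :: (real ^ 'n) set))"
    unfolding rational_cubes_def using finite_reduced_points[of I q] emeasure_rational_cube[OF q d(1), of I]
    by (intro measure_finite_Union) auto
  also have "\<dots> = real (card (reduced_points I q)) * (2 * \<delta> / real q) ^ card I"
    by (simp add: m)
  also have "\<dots> \<ge> (real q ^ card I / 4) * (2 * \<delta> / real q) ^ card I"
    using card_reduced_points_ge[of I q] I q d by (intro mult_right_mono) auto
  also have "(real q ^ card I / 4) * (2 * \<delta> / real q) ^ card I = (2 ^ card I / 4) * \<delta> ^ card I"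
    using q by (simp add: power_divide power_mult_distrib)
  also have "\<dots> \<ge> 1 * \<delta> ^ card I"
  proof (rule mult_right_mono)
    have "(2::real) ^ 2 \<le> 2 ^ card I" using I by (intro power_increasing) auto
    then show "1 \<le> (2::real) ^ card I / 4" by simp
  qed (use d in simp)
  finally show ?thesis by simp
qed

text \<open>Cubes that meet satisfy |p_j r - s_j q| < X in every coordinate. If some pair meets, one
  of these numbers is a nonzero multiple of gcd q r, so X exceeds the gcd and at most (3 X)^n pairs
  meet. Each overlap has measure at most (2 mn)^n, and 6 X mn = 12 \<delta> \<epsilon> because mn mx
  = \<delta> \<epsilon> / (q r).\<close>

lemma measure_rational_cubes_Int_le:
  fixes I :: "'n::finite set"
  assumes q: "q \<ge> 1" "r \<ge> 1" "q \<noteq> r" and d: "0 \<le> \<delta>" "0 \<le> \<epsilon>"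
  shows "measure lborel (rational_cubes I q \<delta> \<inter> rational_cubes I r \<epsilon> :: (real ^ 'n) set) \<le> 12 ^ card I * \<delta> ^ card I * \<epsilon> ^ card I"
proof -
  define mn where "mn = min (\<delta> / real q) (\<epsilon> / real r)"
  define mx where "mx = max (\<delta> / real q) (\<epsilon> / real r)"
  have mm: "mn \<ge> 0" "mx \<ge> 0" using d by (auto simp: mn_def mx_def le_max_iff_disj)
  have mnmx: "mn * mx = (\<delta> / real q) * (\<epsilon> / real r)"
    by (simp add: mn_def mx_def min_def max_def mult.commute)
  \<comment> \<open>Comes from \<delta> / q + \<epsilon> / r <= 2 mx after clearing
    denominators.\<close>
  define X where "X = 2 * mx * real q * real r"
  define C where "C = {(a, b). a < q \<and> b < r \<and> \<bar>real a * real r - real b * real q\<bar> < X}"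
  define J where "J = {(p, s). p \<in> reduced_points I q \<and> s \<in> reduced_points I r \<and>
      rational_cube I q \<delta> p \<inter> rational_cube I r \<epsilon> s \<noteq> ({} :: (real ^ 'n) set)}"
  have finJ: "finite J"
    by (rule finite_subset[of _ "reduced_points I q \<times> reduced_points I r"])
       (auto simp: J_def finite_reduced_points)
  have close: "\<bar>real (p j) * real r - real (s j) * real q\<bar> < X" if pj: "(p, s) \<in> J" "j \<in> I" for p s j
  proof -
    obtain x :: "real ^ 'n" where x: "x \<in> rational_cube I q \<delta> p" "x \<in> rational_cube I r \<epsilon> s"
      using pj by (auto simp: J_def)
    have 1: "\<bar>real q * x $ j - real (p j)\<bar> < \<delta>" and 2: "\<bar>real r * x $ j - real (s j)\<bar> < \<epsilon>"
      using x pj by (auto simp: rational_cube_iff[OF q(1)] rational_cube_iff[OF q(2)])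
    have 3: "real r * \<bar>real q * x $ j - real (p j)\<bar> < real r * \<delta>" using 1 q by simp
    have 4: "real q * \<bar>real r * x $ j - real (s j)\<bar> < real q * \<epsilon>" using 2 q by simp
    have "\<bar>real (p j) * real r - real (s j) * real q\<bar> =
        \<bar>real q * (real r * x $ j - real (s j)) - real r * (real q * x $ j - real (p j))\<bar>"
      by (simp add: algebra_simps)
    also have "\<dots> \<le> \<bar>real q * (real r * x $ j - real (s j))\<bar> + \<bar>real r * (real q * x $ j - real (p j))\<bar>"
      by (rule abs_triangle_ineq4)
    also have "\<dots> < real r * \<delta> + real q * \<epsilon>" using 3 4 by (simp add: abs_mult)
    also have "\<dots> = (\<delta> / real q + \<epsilon> / real r) * real q * real r" using q by (simp add: field_simps)
    also have "\<dots> \<le> X" unfolding X_def mx_def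
      by (intro mult_right_mono) auto
    finally show ?thesis .
  qed
  have sub: "rational_cubes I q \<delta> \<inter> rational_cubes I r \<epsilon> =
      (\<Union>z\<in>J. rational_cube I q \<delta> (fst z) \<inter> rational_cube I r \<epsilon> (snd z) :: (real ^ 'n) set)"
    by (fastforce simp: rational_cubes_def J_def)
  have each: "measure lborel (rational_cube I q \<delta> p \<inter> rational_cube I r \<epsilon> s :: (real ^ 'n) set) \<le> (2 * mn) ^ card I"
    for p s
  proof -
    have 1: "emeasure lborel (rational_cube I q \<delta> p \<inter> rational_cube I r \<epsilon> s :: (real ^ 'n) set)
        \<le> ennreal ((2 * \<delta> / real q) ^ card I)"
      using emeasure_mono[of "rational_cube I q \<delta> p \<inter> rational_cube I r \<epsilon> s" "rational_cube I q \<delta> p" "lborel :: (real ^ 'n) measure"]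
      unfolding emeasure_rational_cube[OF q(1) d(1)] by simp
    have 2: "emeasure lborel (rational_cube I q \<delta> p \<inter> rational_cube I r \<epsilon> s :: (real ^ 'n) set)
        \<le> ennreal ((2 * \<epsilon> / real r) ^ card I)"
      using emeasure_mono[of "rational_cube I q \<delta> p \<inter> rational_cube I r \<epsilon> s" "rational_cube I r \<epsilon> s" "lborel :: (real ^ 'n) measure"]
      unfolding emeasure_rational_cube[OF q(2) d(2)] by simp
    have "emeasure lborel (rational_cube I q \<delta> p \<inter> rational_cube I r \<epsilon> s :: (real ^ 'n) set)
        \<le> ennreal ((2 * mn) ^ card I)"
    proof (cases "\<delta> / real q \<le> \<epsilon> / real r")
      case True
      then have "mn = \<delta> / real q" by (simp add: mn_def)
      then show ?thesis using 1 by simp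
    next
      case False
      then have "mn = \<epsilon> / real r" by (simp add: mn_def)
      then show ?thesis using 2 by simp
    qed
    then show ?thesis using mm by (simp add: measure_def enn2real_leI)
  qed
  show ?thesis
  proof (cases "J = {}")
    case True
    then show ?thesis unfolding sub using d by simp
  next
    case False
    then obtain p s where ps: "(p, s) \<in> J" by auto
    then obtain j where j: "j \<in> I" "p j * r \<noteq> s j * q"
      using reduced_points_distinct[OF q(1) q(3), of p I s] by (auto simp: J_def)
    define z where "z = int (p j) * int r - int (s j) * int q"
    have "z \<noteq> 0" using j(2) unfolding z_def by (metis eq_iff_diff_eq_0 of_nat_eq_iff of_nat_mult)
    moreover have "int (gcd q r) dvd z" unfolding z_def by (intro dvd_diff dvd_mult) auto
    ultimately have "\<bar>int (gcd q r)\<bar> \<le> \<bar>z\<bar>" by (rule dvd_imp_le_int)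
    then have "real (gcd q r) \<le> real_of_int \<bar>z\<bar>" by linarith
    also have "real_of_int \<bar>z\<bar> = \<bar>real (p j) * real r - real (s j) * real q\<bar>"
      by (simp add: z_def)
    also have "\<dots> < X" by (rule close[OF ps j(1)])
    finally have X: "real (gcd q r) < X" .
    note C = card_close_pairs[OF q(1,2) X, folded C_def]
    \<comment> \<open>A pair of vectors is read as a vector of pairs, so that the count factors over
      the coordinates.\<close>
    define h where "h = (\<lambda>(p :: 'n \<Rightarrow> nat, s :: 'n \<Rightarrow> nat). \<lambda>j\<in>I. (p j, s j))"
    have "inj_on h J"
    proof (rule inj_onI, clarify)
      fix p s p' s' assume *: "(p, s) \<in> J" "(p', s') \<in> J" "h (p, s) = h (p', s')"
      have "p j = p' j \<and> s j = s' j" if "j \<in> I" for j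
        using fun_cong[OF *(3), of j] that by (simp add: h_def)
      with * show "p = p' \<and> s = s'"
        by (auto simp: J_def reduced_points_def intro!: PiE_ext[of _ I])
    qed
    moreover have "h ` J \<subseteq> I \<rightarrow>\<^sub>E C"
    proof (rule image_subsetI)
      fix z assume "z \<in> J"
      then obtain p s where z: "z = (p, s)" and ps: "(p, s) \<in> J" by (cases z) auto
      have "(p j, s j) \<in> C" if "j \<in> I" for j
        using close[OF ps that] ps that by (auto simp: C_def J_def reduced_points_def PiE_iff)
      then show "h z \<in> I \<rightarrow>\<^sub>E C" by (auto simp: h_def z)
    qed
    ultimately have "card J \<le> card (I \<rightarrow>\<^sub>E C)"
      using C(1) by (intro card_inj_on_le) (auto intro: finite_PiE)
    also have "\<dots> = card C ^ card I" by (simp add: card_PiE)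
    finally have "real (card J) \<le> real (card C) ^ card I"
      by (metis of_nat_le_iff of_nat_power)
    also have "\<dots> \<le> (3 * X) ^ card I" using C(2) by (intro power_mono) auto
    finally have cJ: "real (card J) \<le> (3 * X) ^ card I" .
    have "measure lborel (rational_cubes I q \<delta> \<inter> rational_cubes I r \<epsilon> :: (real ^ 'n) set)
        \<le> (\<Sum>z\<in>J. measure lborel (rational_cube I q \<delta> (fst z) \<inter> rational_cube I r \<epsilon> (snd z) :: (real ^ 'n) set))"
      unfolding sub
      by (rule measure_UNION_le[OF finJ]) simp
    also have "\<dots> \<le> (\<Sum>z\<in>J. (2 * mn) ^ card I)"
      by (rule sum_mono, rule each)
    also have "\<dots> = real (card J) * (2 * mn) ^ card I" by simp
    also have "\<dots> \<le> (3 * X) ^ card I * (2 * mn) ^ card I"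
      using cJ mm by (intro mult_right_mono) auto
    also have "\<dots> = ((3 * X) * (2 * mn)) ^ card I"
      by (rule power_mult_distrib[symmetric])
    also have "(3 * X) * (2 * mn) = 12 * \<delta> * \<epsilon>"
    proof -
      have "(3 * X) * (2 * mn) = 12 * ((mn * mx) * (real q * real r))"
        unfolding X_def by algebra
      also have "(mn * mx) * (real q * real r) = \<delta> * \<epsilon>"
        unfolding mnmx using q by (simp add: field_simps)
      finally show ?thesis by simp
    qed
    finally show ?thesis by (simp only: power_mult_distrib)
  qed
qed

section \<open>Simultaneous approximation without monotonicity\<close>

text \<open>Bonferroni's inequality with lower bounds \<open>a\<close> in place of the measures. In
  the induction the new set x shares at most K a_x (sum a S) with the earlier union, which is the
  mixed term of the square.\<close>

lemma measure_UN_ge: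
  assumes S: "finite S" and F: "\<And>i. i \<in> S \<Longrightarrow> F i \<in> fmeasurable M"
    and a: "\<And>i. i \<in> S \<Longrightarrow> a i \<le> measure M (F i)"
    and K: "K \<ge> 0"
    and pair: "\<And>i j. i \<in> S \<Longrightarrow> j \<in> S \<Longrightarrow> i \<noteq> j \<Longrightarrow> measure M (F i \<inter> F j) \<le> K * a i * a j"
  shows "sum a S - K * (sum a S)\<^sup>2 / 2 \<le> measure M (\<Union>i\<in>S. F i)"
  using S F a pair
proof (induction S rule: finite_induct)
  case (insert x S)
  let ?U = "\<Union>i\<in>S. F i"
  have U: "?U \<in> fmeasurable M"
    by (intro fmeasurable.finite_UN insert.hyps(1) insert.prems(1)) simp
  have Fx: "F x \<in> fmeasurable M" by (rule insert.prems(1)) simp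
  have IH: "sum a S - K * (sum a S)\<^sup>2 / 2 \<le> measure M ?U"
    by (rule insert.IH) (simp_all add: insert.prems)
  have "measure M (F x \<inter> ?U) = measure M (\<Union>j\<in>S. F x \<inter> F j)" by (simp only: Int_UN_distrib)
  also have "\<dots> \<le> (\<Sum>j\<in>S. measure M (F x \<inter> F j))"
  proof (rule measure_UNION_le[OF insert.hyps(1)])
    fix j assume "j \<in> S"
    then have "F x \<in> sets M" "F j \<in> sets M" using insert.prems(1) by (auto intro: fmeasurableD)
    then show "F x \<inter> F j \<in> sets M" by (rule sets.Int)
  qed
  also have "\<dots> \<le> (\<Sum>j\<in>S. K * a x * a j)"
    using insert.hyps(2) by (intro sum_mono insert.prems(3)) auto
  also have "\<dots> = K * a x * sum a S" by (simp add: sum_distrib_left)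
  finally have Int: "measure M (F x \<inter> ?U) \<le> K * a x * sum a S" .
  have "measure M (\<Union>i\<in>insert x S. F i) = measure M (F x) + measure M ?U - measure M (F x \<inter> ?U)"
    using measure_Un3[OF Fx U] by simp
  also have "\<dots> \<ge> a x + (sum a S - K * (sum a S)\<^sup>2 / 2) - K * a x * sum a S"
    using insert.prems(2)[of x] IH Int by simp
  finally have "a x + (sum a S - K * (sum a S)\<^sup>2 / 2) - K * a x * sum a S \<le> measure M (\<Union>i\<in>insert x S. F i)" .
  moreover have "K * (a x)\<^sup>2 \<ge> 0" using K by simp
  ultimately show ?case using insert.hyps by (simp add: power2_eq_square algebra_simps add_divide_distrib)
qed simp

text \<open>The first partial sum to reach t exceeds it by less than its last term, and no term
  exceeds t.\<close>

lemma exists_sum_between: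
  fixes a :: "nat \<Rightarrow> real"
  assumes a: "\<And>i. 0 \<le> a i" "\<And>i. a i \<le> t" and div: "\<not> summable a"
  shows "\<exists>N'. t \<le> sum a {N..<N'} \<and> sum a {N..<N'} \<le> 2 * t"
proof -
  have t: "t \<ge> 0" using a[of 0] by linarith
  have ex: "\<exists>N'. t \<le> sum a {N..<N'}"
  proof (rule ccontr)
    assume "\<not> ?thesis"
    then have less: "sum a {N..<m} < t" for m by (meson not_le)
    have "summable a"
    proof (rule summableI_nonneg_bounded)
      fix m
      have "sum a {..<m} \<le> sum a ({..<N} \<union> {N..<m})" using a by (intro sum_mono2) auto
      also have "\<dots> = sum a {..<N} + sum a {N..<m}" by (intro sum.union_disjoint) auto
      finally show "sum a {..<m} \<le> sum a {..<N} + t" using less[of m] by linarith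
    qed (use a in simp)
    with div show False by simp
  qed
  define N' where "N' = (LEAST N'. t \<le> sum a {N..<N'})"
  have 1: "t \<le> sum a {N..<N'}" unfolding N'_def using ex by (rule LeastI_ex)
  have "sum a {N..<N'} \<le> 2 * t"
  proof (cases "N' \<le> N")
    case True
    then show ?thesis using t by simp
  next
    case False
    then obtain k where k: "N' = Suc k" "N \<le> k" by (cases N') auto
    have "k < (LEAST N'. t \<le> sum a {N..<N'})" using k N'_def by simp
    then have "\<not> t \<le> sum a {N..<k}" by (rule not_less_Least)
    then show ?thesis using k a(2)[of k] by simp
  qed
  with 1 show ?thesis by blast
qed

text \<open>Each tail contains a finite block with sum A between 1 / (2 K) and 1 / K. As K A <= 1,
  the Bonferroni bound A - K A^2 / 2 is at least A / 2 >= 1 / (4 K). Containment in \<open>B\<close>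
  permits passing to the decreasing limit of the tail unions.\<close>

lemma measure_limsup_ge:
  fixes F :: "nat \<Rightarrow> 'a set"
  assumes F: "\<And>i. F i \<in> sets M" "\<And>i. F i \<subseteq> B" and B: "B \<in> fmeasurable M"
    and a: "\<And>i. 0 \<le> a i" "\<And>i. a i \<le> measure M (F i)" "\<And>i. a i \<le> 1 / (2 * K)"
    and K: "K > 0" and div: "\<not> summable a"
    and pair: "\<And>i j. i \<noteq> j \<Longrightarrow> measure M (F i \<inter> F j) \<le> K * a i * a j"
  shows "1 / (4 * K) \<le> measure M (\<Inter>N. \<Union>i\<in>{N..}. F i)"
proof -
  define G where "G N = (\<Union>i\<in>{N..}. F i)" for N
  have Fm: "F i \<in> fmeasurable M" for i by (rule fmeasurableI2[OF B F(2) F(1)])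
  have G: "G N \<in> sets M" for N unfolding G_def using F by (intro sets.countable_UN') auto
  have GB: "G N \<subseteq> B" for N unfolding G_def using F by blast
  have Gm: "G N \<in> fmeasurable M" for N using B GB G by (rule fmeasurableI2)
  have ge: "1 / (4 * K) \<le> measure M (G N)" for N
  proof -
    obtain N' where N': "1 / (2 * K) \<le> sum a {N..<N'}" "sum a {N..<N'} \<le> 2 * (1 / (2 * K))"
      using exists_sum_between[OF a(1,3) div] by blast
    define A where "A = sum a {N..<N'}"
    have A: "1 / (2 * K) \<le> A" "K * A \<le> 1" using N' K by (simp_all add: A_def field_simps)
    have A0: "A \<ge> 0" unfolding A_def using a by (simp add: sum_nonneg)
    have "1 / (4 * K) \<le> A / 2" using A(1) by simp
    also have "A / 2 \<le> A - K * A\<^sup>2 / 2"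
      using mult_right_mono[OF A(2) A0] by (simp add: power2_eq_square)
    also have "\<dots> \<le> measure M (\<Union>i\<in>{N..<N'}. F i)"
      unfolding A_def by (rule measure_UN_ge) (use K in \<open>simp_all add: Fm a(2) pair\<close>)
    also have "\<dots> \<le> measure M (G N)"
      by (intro measure_mono_fmeasurable sets.finite_UN F Gm) (auto simp: G_def)
    finally show ?thesis .
  qed
  have lim: "(\<lambda>N. measure M (G N)) \<longlonglongrightarrow> measure M (\<Inter>N. G N)"
  proof (rule Lim_measure_decseq)
    show "range G \<subseteq> sets M" using G by blast
    show "decseq G" unfolding decseq_def G_def by (intro allI impI UN_mono) auto
    show "emeasure M (G i) \<noteq> \<infinity>" for i using fmeasurableD2[OF Gm] by simp
  qed
  have "1 / (4 * K) \<le> measure M (\<Inter>N. G N)"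
    by (rule LIMSEQ_le_const[OF lim]) (intro exI allI impI ge)
  then show ?thesis unfolding G_def .
qed

section \<open>Simultaneously approximable points\<close>

lemma near_int_add_int:
  "near_int \<delta> (t + real_of_int k) \<longleftrightarrow> near_int \<delta> t"
proof -
  have *: "near_int \<delta> (t + real_of_int k)" if "near_int \<delta> t" for t k
  proof -
    from that obtain p :: int where "\<bar>t - of_int p\<bar> < \<delta>" by (auto simp: near_int_def)
    then have "\<bar>t + real_of_int k - of_int (p + k)\<bar> < \<delta>" by simp
    then show ?thesis unfolding near_int_def by blast
  qed
  show ?thesis using *[of t k] *[of "t + real_of_int k" "- k"] by auto
qed

definition simul_approximable :: "'n set \<Rightarrow> (nat \<Rightarrow> real) \<Rightarrow> (real ^ 'n::finite) set" where
  "simul_approximable I \<phi> = {x. \<exists>\<^sub>\<infinity>q. q \<ge> 1 \<and> (\<forall>j\<in>I. near_int (\<phi> q) (real q * x $ j))}"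

lemma open_near_int: "open {t. near_int \<delta> (a * t)}"
proof -
  have "{t. near_int \<delta> (a * t)} = (\<Union>p::int. {t. \<bar>a * t - of_int p\<bar> < \<delta>})"
    by (auto simp: near_int_def)
  moreover have "open {t. \<bar>a * t - of_int p\<bar> < \<delta>}" for p :: int
    by (intro open_Collect_less continuous_intros)
  ultimately show ?thesis by auto
qed

lemma sets_near_int_all:
  fixes I :: "'n::finite set"
  shows "{x :: real ^ 'n. \<forall>j\<in>I. near_int \<delta> (a * x $ j)} \<in> sets borel"
proof -
  have "{x :: real ^ 'n. \<forall>j\<in>I. near_int \<delta> (a * x $ j)}
      = {x. \<forall>j. x $ j \<in> (if j \<in> I then {t. near_int \<delta> (a * t)} else UNIV)}"
    by auto
  also have "\<dots> \<in> sets borel"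
    by (rule sets_Collect_vec) (simp add: open_near_int)
  finally show ?thesis .
qed

lemma sets_simul_approximable: "simul_approximable I \<phi> \<in> sets borel"
proof -
  define S :: "nat \<Rightarrow> (real ^ 'a) set" where "S q = {x. q \<ge> 1 \<and> (\<forall>j\<in>I. near_int (\<phi> q) (real q * x $ j))}" for q
  have S: "S q \<in> sets borel" for q
  proof (cases "q \<ge> 1")
    case True
    then have "S q = {x. \<forall>j\<in>I. near_int (\<phi> q) (real q * x $ j)}" by (simp add: S_def)
    then show ?thesis by (simp only: sets_near_int_all)
  next
    case False
    then have "S q = {}" by (simp add: S_def)
    then show ?thesis by (simp only: sets.empty_sets)
  qed
  have U: "(\<Union>q\<in>{N..}. S q) \<in> sets borel" for N
    by (rule sets.countable_UN''[OF _ S]) simp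
  have "(\<Inter>N. \<Union>q\<in>{N..}. S q) \<in> sets borel"
    by (rule sets.countable_INT''[OF _ _ U]) simp_all
  moreover have "x \<in> simul_approximable I \<phi> \<longleftrightarrow> x \<in> (\<Inter>N. \<Union>q\<in>{N..}. S q)" for x
    unfolding simul_approximable_def INFM_nat_le S_def by blast
  then have "simul_approximable I \<phi> = (\<Inter>N. \<Union>q\<in>{N..}. S q)" by (rule set_eqI)
  ultimately show ?thesis by simp
qed

lemma emeasure_lborel_affine_vec:
  fixes Y :: "(real ^ 'n::finite) set"
  assumes Y: "Y \<in> sets borel" and c: "c > 0"
  shows "emeasure lborel Y = ennreal (c ^ CARD('n)) * emeasure lborel {x. t + c *\<^sub>R x \<in> Y}"
proof -
  have m: "(\<lambda>x. t + c *\<^sub>R x) \<in> borel_measurable (lborel :: (real ^ 'n) measure)"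
    by (auto intro!: borel_measurable_continuous_onI continuous_intros)
  have "(lborel :: (real ^ 'n) measure)
      = density (distr lborel borel (\<lambda>x. t + c *\<^sub>R x)) (\<lambda>_. ennreal (\<bar>c\<bar> ^ DIM(real ^ 'n)))"
    by (rule lborel_affine) (use c in simp)
  then have "emeasure lborel Y = emeasure (density (distr lborel borel (\<lambda>x. t + c *\<^sub>R x)) (\<lambda>_. ennreal (\<bar>c\<bar> ^ DIM(real ^ 'n)))) Y"
    by (rule arg_cong[where f = "\<lambda>M. emeasure M Y"])
  also have "\<dots> = ennreal (\<bar>c\<bar> ^ DIM(real ^ 'n)) * emeasure (distr lborel borel (\<lambda>x. t + c *\<^sub>R x)) Y"
    using Y by (intro emeasure_density_const) simp
  also have "emeasure (distr lborel borel (\<lambda>x. t + c *\<^sub>R x)) Y = emeasure lborel ((\<lambda>x. t + c *\<^sub>R x) -` Y)"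
    using emeasure_distr[OF m Y] by simp
  finally show ?thesis using c by (simp add: vimage_def)
qed

lemma rational_cube_mono:
  assumes "q \<ge> 1" "\<delta> \<le> \<epsilon>"
  shows "rational_cube I q \<delta> p \<subseteq> rational_cube I q \<epsilon> p"
proof
  fix x assume "x \<in> rational_cube I q \<delta> p"
  then show "x \<in> rational_cube I q \<epsilon> p"
    unfolding rational_cube_iff[OF assms(1)] using assms(2) by (blast intro: less_le_trans)
qed

lemma rational_cubes_bounded:
  fixes I :: "'n::finite set"
  assumes q: "q \<ge> 1" and d: "\<delta> \<le> 1"
  shows "rational_cubes I q \<delta> \<subseteq> cbox (\<chi> j. - 1) (\<chi> j. 2)"
proof
  fix x :: "real ^ 'n" assume "x \<in> rational_cubes I q \<delta>"
  then obtain p where p: "p \<in> reduced_points I q" and x: "x \<in> rational_cube I q \<delta> p"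
    by (auto simp: rational_cubes_def)
  have "- 1 \<le> x $ j \<and> x $ j \<le> 2" for j
  proof (cases "j \<in> I")
    case True
    have "p j < q" using p True by (auto simp: reduced_points_def PiE_iff)
    then have pj: "real (p j) + 1 \<le> real q" by linarith
    have "\<bar>real q * x $ j - real (p j)\<bar> < \<delta>"
      using x True by (simp add: rational_cube_iff[OF q])
    then have "real q * x $ j < real q * 2" "real q * x $ j > real q * (- 1)"
      using d pj q by linarith+
    moreover have "real q > 0" using q by simp
    ultimately have "x $ j < 2" "x $ j > - 1"
      by (simp_all only: mult_less_cancel_left_pos)
    then show ?thesis by simp
  next
    case False
    then have "0 \<le> x $ j \<and> x $ j < 1" using x by (simp add: rational_cube_iff[OF q])
    then show ?thesis by simp
  qed
  then show "x \<in> cbox (\<chi> j. - 1) (\<chi> j. 2)" by (simp add: mem_box_cart)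
qed

text \<open>The bound does not depend on the radii, so it survives dividing all of them by
  arbitrarily large constants.\<close>

lemma measure_limsup_rational_cubes_ge:
  fixes I :: "'n::finite set"
  assumes I: "card I \<ge> 2" and phi: "\<And>q. 0 \<le> \<phi> q" "\<And>q. \<phi> q \<le> 1 / 24"
    and div: "\<not> summable (\<lambda>q. \<phi> (Suc q) ^ card I)"
  shows "1 / (4 * 12 ^ card I)
    \<le> measure lborel (\<Inter>N. \<Union>i\<in>{N..}. rational_cubes I (Suc i) (\<phi> (Suc i)) :: (real ^ 'n) set)"
proof (rule measure_limsup_ge[where a = "\<lambda>q. \<phi> (Suc q) ^ card I" and B = "cbox (\<chi> j. - 1) (\<chi> j. 2)"])
  fix i j :: nat
  have half: "\<phi> q \<le> 1 / 2" "\<phi> q \<le> 1" for q using phi(2)[of q] by linarith+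
  show "rational_cubes I (Suc i) (\<phi> (Suc i)) \<in> sets lborel" by simp
  show "rational_cubes I (Suc i) (\<phi> (Suc i)) \<subseteq> cbox (\<chi> j. - 1) (\<chi> j. 2)"
    by (rule rational_cubes_bounded) (simp_all add: half)
  show "0 \<le> \<phi> (Suc i) ^ card I" using phi(1) by simp
  show "\<phi> (Suc i) ^ card I \<le> measure lborel (rational_cubes I (Suc i) (\<phi> (Suc i)))"
    by (rule measure_rational_cubes_ge[OF I _ phi(1) half(1)]) simp
  \<comment> \<open>24 is twice 12: with K = 12^n from the overlap bound, each term has to be at
    most 1 / (2 K).\<close>
  have "\<phi> (Suc i) ^ card I \<le> (1 / 24) ^ card I" using phi by (intro power_mono) auto
  also have "(1 / 24 :: real) ^ card I = (1 / 12) ^ card I * (1 / 2) ^ card I"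
    by (simp add: power_mult_distrib[symmetric])
  also have "\<dots> \<le> (1 / 12) ^ card I * (1 / 2) ^ 1"
    using I by (intro mult_left_mono power_decreasing) auto
  finally show "\<phi> (Suc i) ^ card I \<le> 1 / (2 * 12 ^ card I)"
    by (simp add: power_one_over divide_simps)
  show "measure lborel (rational_cubes I (Suc i) (\<phi> (Suc i)) \<inter> rational_cubes I (Suc j) (\<phi> (Suc j)))
      \<le> 12 ^ card I * \<phi> (Suc i) ^ card I * \<phi> (Suc j) ^ card I" if "i \<noteq> j"
    by (rule measure_rational_cubes_Int_le) (simp_all add: phi(1) that)
qed (use div in \<open>simp_all add: fmeasurable_cbox\<close>)

text \<open>Zero-one law: the set of points
  approximable with all the radii \<open>\<phi> q / M\<close> has positive measure, so it nearly fills some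
  dyadic cube of side \<open>2\<^sup>-\<^sup>k\<close>; multiplication by \<open>2\<^sup>k\<close> maps
  the cube onto a unit cube and its points to \<open>\<phi>\<close>-approximable ones.\<close>

theorem gallagher:
  fixes I :: "'n::finite set"
  assumes I: "card I \<ge> 2" and phi: "\<And>q. 0 \<le> \<phi> q" "\<And>q. \<phi> q \<le> 1 / 24"
    and div: "\<not> summable (\<lambda>q. \<phi> (Suc q) ^ card I)"
  shows "AE x :: real ^ 'n in lborel. x \<in> simul_approximable I \<phi>"
proof -
  define L :: "nat \<Rightarrow> (real ^ 'n) set"
    where "L k = (\<Inter>N. \<Union>i\<in>{N..}. rational_cubes I (Suc i) (\<phi> (Suc i) / (real k + 1)))" for k
  \<comment> \<open>The sets \<open>L k\<close> decrease and their measures share one positive lower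
    bound, so A has positive measure.\<close>
  define A where "A = (\<Inter>k. L k)"
  have U: "(\<Union>i\<in>{N..}. rational_cubes I (Suc i) (\<phi> (Suc i) / (real k + 1)) :: (real ^ 'n) set) \<in> sets borel" for N k
    by (rule sets.countable_UN'') simp_all
  have L: "L k \<in> sets borel" for k
    unfolding L_def by (rule sets.countable_INT''[OF _ _ U]) simp_all
  have A: "A \<in> sets borel"
    unfolding A_def by (rule sets.countable_INT''[OF _ _ L]) simp_all
  have L_ge: "1 / (4 * 12 ^ card I) \<le> measure lborel (L k)" for k
    unfolding L_def
  proof (rule measure_limsup_rational_cubes_ge[OF I])
    fix q
    show "0 \<le> \<phi> q / (real k + 1)" using phi(1) by simp
    have "\<phi> q / (real k + 1) \<le> \<phi> q / 1" using phi(1) by (intro divide_left_mono) auto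
    then show "\<phi> q / (real k + 1) \<le> 1 / 24" using phi(2)[of q] by simp
  next
    show "\<not> summable (\<lambda>q. (\<phi> (Suc q) / (real k + 1)) ^ card I)"
    proof
      assume "summable (\<lambda>q. (\<phi> (Suc q) / (real k + 1)) ^ card I)"
      then have "summable (\<lambda>q. (\<phi> (Suc q) / (real k + 1)) ^ card I * (real k + 1) ^ card I)"
        by (rule summable_mult2)
      then show False using div by (simp add: power_mult_distrib[symmetric])
    qed
  qed
  have L_sub: "L k \<subseteq> cbox (\<chi> j. - 1) (\<chi> j. 2)" for k
  proof -
    have "rational_cubes I (Suc i) (\<phi> (Suc i) / (real k + 1)) \<subseteq> (cbox (\<chi> j. - 1) (\<chi> j. 2) :: (real ^ 'n) set)" for i
    proof (rule rational_cubes_bounded)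
      have "\<phi> (Suc i) / (real k + 1) \<le> \<phi> (Suc i) / 1" using phi(1) by (intro divide_left_mono) auto
      then show "\<phi> (Suc i) / (real k + 1) \<le> 1" using phi(2)[of "Suc i"] by simp
    qed simp
    then show ?thesis unfolding L_def by blast
  qed
  have Lm: "L k \<in> fmeasurable lborel" for k
    by (rule fmeasurableI2[OF _ L_sub]) (simp_all add: L fmeasurable_cbox)
  have "(\<lambda>k. measure lborel (L k)) \<longlonglongrightarrow> measure lborel (\<Inter>k. L k)"
  proof (rule Lim_measure_decseq)
    show "range L \<subseteq> sets lborel" using L by auto
    show "decseq L"
    proof (rule decseq_SucI)
      fix k
      have "\<phi> (Suc i) / (real (Suc k) + 1) \<le> \<phi> (Suc i) / (real k + 1)" for i
        using phi(1) by (intro divide_left_mono) auto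
      then have "rational_cubes I (Suc i) (\<phi> (Suc i) / (real (Suc k) + 1))
          \<subseteq> (rational_cubes I (Suc i) (\<phi> (Suc i) / (real k + 1)) :: (real ^ 'n) set)" for i
        unfolding rational_cubes_def by (intro UN_mono rational_cube_mono) simp_all
      then show "L (Suc k) \<subseteq> L k" unfolding L_def by blast
    qed
    show "emeasure lborel (L k) \<noteq> \<infinity>" for k using fmeasurableD2[OF Lm] by simp
  qed
  then have "1 / (4 * 12 ^ card I) \<le> measure lborel A"
    unfolding A_def by (rule LIMSEQ_le_const) (intro exI allI impI L_ge)
  moreover have "(0::real) < 1 / (4 * 12 ^ card I)" by simp
  ultimately have mA: "measure lborel A > 0" by linarith
  have "emeasure lborel A \<le> emeasure lborel (L 0)"
    unfolding A_def by (intro emeasure_mono) (auto simp: L)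
  then have A_fin: "emeasure lborel A < \<infinity>"
    using fmeasurableD2[OF Lm[of 0]] by (simp add: less_top[symmetric] top_unique) (metis le_less_trans top.not_eq_extremum)
  have A_pos: "emeasure lborel A > 0"
    using mA by (metis measure_def enn2real_0 less_irrefl zero_less_iff_neq_zero)
  have A_scaled: "2 ^ k *\<^sub>R x \<in> simul_approximable I \<phi>" if x: "x \<in> A" for x k
  proof -
    \<comment> \<open>\<open>L (2 ^ k - 1)\<close> has its radii divided by exactly 2^k, which
      scaling by 2^k undoes.\<close>
    have pw: "real (2 ^ k - 1) + 1 = 2 ^ k" by (simp add: of_nat_diff)
    have "\<exists>q\<ge>N. q \<ge> 1 \<and> (\<forall>j\<in>I. near_int (\<phi> q) (real q * (2 ^ k *\<^sub>R x) $ j))" for N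
    proof -
      have "x \<in> L (2 ^ k - 1)" using x by (simp add: A_def)
      then obtain i where i: "i \<ge> N" "x \<in> rational_cubes I (Suc i) (\<phi> (Suc i) / (real (2 ^ k - 1) + 1))"
        unfolding L_def by blast
      then obtain p where "x \<in> rational_cube I (Suc i) (\<phi> (Suc i) / 2 ^ k) p"
        unfolding pw rational_cubes_def by blast
      then have p: "\<bar>real (Suc i) * x $ j - real (p j)\<bar> < \<phi> (Suc i) / 2 ^ k" if "j \<in> I" for j
        using that by (subst (asm) rational_cube_iff) simp_all
      have "near_int (\<phi> (Suc i)) (real (Suc i) * (2 ^ k *\<^sub>R x) $ j)" if "j \<in> I" for j
        unfolding near_int_def
      proof (rule exI[of _ "int (2 ^ k * p j)"])
        have "real (Suc i) * (2 ^ k *\<^sub>R x) $ j - real_of_int (int (2 ^ k * p j))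
            = 2 ^ k * (real (Suc i) * x $ j - real (p j))"
          by (simp add: algebra_simps)
        then have "\<bar>real (Suc i) * (2 ^ k *\<^sub>R x) $ j - real_of_int (int (2 ^ k * p j))\<bar>
            = 2 ^ k * \<bar>real (Suc i) * x $ j - real (p j)\<bar>"
          by (simp only: abs_mult) simp
        also have "\<dots> < 2 ^ k * (\<phi> (Suc i) / 2 ^ k)"
          using p[OF that] by (intro mult_strict_left_mono) simp_all
        finally show "\<bar>real (Suc i) * (2 ^ k *\<^sub>R x) $ j - real_of_int (int (2 ^ k * p j))\<bar> < \<phi> (Suc i)"
          by simp
      qed
      then show ?thesis using i(1) by (intro exI[of _ "Suc i"]) simp
    qed
    then show ?thesis unfolding simul_approximable_def INFM_nat_le by blast
  qed
  define Z where "Z = - simul_approximable I \<phi>"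
  have Z: "Z \<in> sets borel" unfolding Z_def by (rule borel_comp[OF sets_simul_approximable])
  have ZC: "Z \<inter> dyadic_cube 0 \<alpha> \<in> sets borel" for \<alpha> using Z by simp
  \<comment> \<open>Periodicity under integer translations, so that a bound on one unit cube holds
    on all of them.\<close>
  have Z_shift: "(\<chi> j. real_of_int (\<beta> $ j)) + x \<in> Z \<longleftrightarrow> x \<in> Z" for \<beta> :: "int ^ 'n" and x
  proof -
    have "near_int \<delta> (real q * (((\<chi> j. real_of_int (\<beta> $ j)) + x) $ j)) \<longleftrightarrow> near_int \<delta> (real q * x $ j)" for \<delta> q j
    proof -
      have "real q * (((\<chi> j. real_of_int (\<beta> $ j)) + x) $ j) = real q * x $ j + real_of_int (int q * \<beta> $ j)"
        by (simp add: algebra_simps)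
      then show ?thesis by (simp only: near_int_add_int)
    qed
    then show ?thesis unfolding Z_def simul_approximable_def by simp
  qed
  \<comment> \<open>The dense cube of level k misses at most e 2^(-k d) of A, where d =
    \<open>CARD('n)\<close>. Scaled by 2^k, this missing part covers the non-approximable points of
    a unit cube, which therefore have measure at most e.\<close>
  have le: "emeasure lborel (Z \<inter> dyadic_cube 0 \<alpha>) \<le> ennreal e" if e: "0 < e" "e < 1" for e \<alpha>
  proof -
    obtain k \<alpha>0 where k: "emeasure lborel (A \<inter> dyadic_cube k \<alpha>0) > ennreal (1 - e) * emeasure lborel (dyadic_cube k \<alpha>0 :: (real ^ 'n) set)"
      using exists_dense_dyadic_cube[OF A A_pos A_fin e] by blast
    define v :: real where "v = (1 / 2 ^ k) ^ CARD('n)"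
    have v: "v > 0" by (simp add: v_def)
    let ?C = "dyadic_cube k \<alpha>0 :: (real ^ 'n) set"
    have C: "emeasure lborel ?C = ennreal v" unfolding v_def by (rule emeasure_dyadic_cube)
    have Cm: "?C \<in> fmeasurable lborel" by (rule fmeasurableI) (simp_all add: C)
    have ACm: "A \<inter> ?C \<in> fmeasurable lborel" by (rule fmeasurableI2[OF Cm]) (use A in auto)
    have CAm: "?C - A \<in> fmeasurable lborel" by (rule fmeasurableI2[OF Cm]) (use A in auto)
    have mC: "measure lborel ?C = v" using C v by (simp add: measure_def)
    have "ennreal ((1 - e) * v) < ennreal (measure lborel (A \<inter> ?C))"
      using k e v unfolding C emeasure_eq_measure2[OF ACm] by (simp add: ennreal_mult)
    then have 1: "(1 - e) * v < measure lborel (A \<inter> ?C)"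
      using e v by (subst (asm) ennreal_less_iff) auto
    have "measure lborel ?C = measure lborel (A \<inter> ?C) + measure lborel (?C - A)"
    proof -
      have "?C = (A \<inter> ?C) \<union> (?C - A)" by blast
      moreover have "measure lborel ((A \<inter> ?C) \<union> (?C - A)) = measure lborel (A \<inter> ?C) + measure lborel (?C - A)"
        using fmeasurableD2[OF ACm] fmeasurableD2[OF CAm] fmeasurableD[OF ACm] fmeasurableD[OF CAm]
        by (intro measure_Union) auto
      ultimately show ?thesis by simp
    qed
    then have 2: "measure lborel (?C - A) \<le> e * v"
      using 1 mC by (simp add: algebra_simps)
    let ?Y = "Z \<inter> dyadic_cube 0 \<alpha>0"
    have "{x. 0 + 2 ^ k *\<^sub>R x \<in> ?Y} \<subseteq> ?C - A"
      using A_scaled by (auto simp: Z_def dyadic_cube_def)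
    then have "emeasure lborel {x. 0 + 2 ^ k *\<^sub>R x \<in> ?Y} \<le> emeasure lborel (?C - A)"
      using fmeasurableD[OF CAm] by (intro emeasure_mono) simp_all
    also have "\<dots> \<le> ennreal (e * v)"
      unfolding emeasure_eq_measure2[OF CAm] using 2 by (rule ennreal_leI)
    finally have 3: "emeasure lborel {x. 0 + 2 ^ k *\<^sub>R x \<in> ?Y} \<le> ennreal (e * v)" .
    have "emeasure lborel ?Y = ennreal ((2 ^ k) ^ CARD('n)) * emeasure lborel {x. 0 + 2 ^ k *\<^sub>R x \<in> ?Y}"
      by (rule emeasure_lborel_affine_vec[OF ZC]) simp
    also have "\<dots> \<le> ennreal ((2 ^ k) ^ CARD('n)) * ennreal (e * v)"
      using 3 by (rule mult_left_mono) simp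
    also have "\<dots> = ennreal ((2 ^ k) ^ CARD('n) * (e * v))"
      using e v by (simp add: ennreal_mult)
    also have "(2 ^ k) ^ CARD('n) * (e * v) = e"
      by (simp add: v_def power_one_over)
    finally have 4: "emeasure lborel ?Y \<le> ennreal e" .
    let ?t = "(\<chi> j. real_of_int ((\<alpha> - \<alpha>0) $ j)) :: real ^ 'n"
    have "emeasure lborel (Z \<inter> dyadic_cube 0 \<alpha>)
        = ennreal (1 ^ CARD('n)) * emeasure lborel {x. ?t + 1 *\<^sub>R x \<in> Z \<inter> dyadic_cube 0 \<alpha>}"
      by (rule emeasure_lborel_affine_vec[OF ZC]) simp
    also have "{x. ?t + 1 *\<^sub>R x \<in> Z \<inter> dyadic_cube 0 \<alpha>} = ?Y"
    proof -
      have "?t + x \<in> dyadic_cube 0 \<alpha> \<longleftrightarrow> x \<in> dyadic_cube 0 \<alpha>0" for x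
      proof -
        have "\<lfloor>real_of_int m - real_of_int n + y\<rfloor> = m \<longleftrightarrow> \<lfloor>y\<rfloor> = n" for m n and y :: real
          by linarith
        then show ?thesis by (simp add: dyadic_cube_def)
      qed
      then show ?thesis using Z_shift[of "\<alpha> - \<alpha>0"] by (simp only: Int_iff scaleR_one) blast
    qed
    finally show ?thesis using 4 by simp
  qed
  have null: "emeasure lborel (Z \<inter> dyadic_cube 0 \<alpha>) = 0" for \<alpha>
  proof (rule ccontr)
    assume "emeasure lborel (Z \<inter> dyadic_cube 0 \<alpha>) \<noteq> 0"
    moreover have "emeasure lborel (Z \<inter> dyadic_cube 0 \<alpha>) \<noteq> \<infinity>"
      using le[of "1/2" \<alpha>] by (auto simp: top_unique)
    ultimately obtain r where r: "emeasure lborel (Z \<inter> dyadic_cube 0 \<alpha>) = ennreal r" "r > 0"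
      by (cases "emeasure lborel (Z \<inter> dyadic_cube 0 \<alpha>)") (auto simp: less_le)
    define e where "e = min (r / 2) (1 / 2)"
    have e: "0 < e" "e < 1" "e < r" using r(2) by (auto simp: e_def)
    have "ennreal r \<le> ennreal e" using le[OF e(1,2), of \<alpha>] r(1) by simp
    then show False using e by (simp add: ennreal_le_iff)
  qed
  have "(\<Union>\<alpha>. Z \<inter> dyadic_cube 0 \<alpha>) \<in> null_sets lborel"
  proof (rule null_sets_UN)
    show "Z \<inter> dyadic_cube 0 \<alpha> \<in> null_sets lborel" for \<alpha>
      using null[of \<alpha>] ZC[of \<alpha>] by (simp add: null_sets_def)
  qed
  moreover have "{x \<in> space lborel. \<not> x \<in> simul_approximable I \<phi>} \<subseteq> (\<Union>\<alpha>. Z \<inter> dyadic_cube 0 \<alpha>)"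
  proof
    fix x assume "x \<in> {x \<in> space lborel. \<not> x \<in> simul_approximable I \<phi>}"
    then have "x \<in> Z \<inter> dyadic_cube 0 (\<chi> j. \<lfloor>x $ j\<rfloor>)" by (simp add: Z_def dyadic_cube_def)
    then show "x \<in> (\<Union>\<alpha>. Z \<inter> dyadic_cube 0 \<alpha>)" by blast
  qed
  ultimately show ?thesis by (rule AE_I')
qed

section \<open>Null sets from convergent series\<close>

text \<open>For \<delta> < 1 only integers with |p| <= q m + 1 matter: 2 q m + 3 intervals of length
  2 \<delta> / q. For \<delta> >= 1 the length 2 m of the whole interval is already below the
  bound.\<close>

lemma measure_near_int_le:
  assumes q: "q \<ge> 1" and m: "m \<ge> 1" and d: "\<delta> \<ge> 0"
  shows "measure lborel ({- real m..real m} \<inter> {t. near_int \<delta> (real q * t)}) \<le> (4 * real m + 6) * \<delta>"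
proof (cases "\<delta> \<ge> 1")
  case True
  have "measure lborel ({- real m..real m} \<inter> {t. near_int \<delta> (real q * t)}) \<le> measure lborel {- real m..real m}"
    using fmeasurable_cbox[of "- real m" "real m"]
    by (intro measure_mono_fmeasurable) (auto simp: open_near_int)
  also have "\<dots> = 2 * real m" by simp
  also have "\<dots> \<le> (4 * real m + 6) * 1" by simp
  also have "\<dots> \<le> (4 * real m + 6) * \<delta>" using True by (intro mult_left_mono) auto
  finally show ?thesis .
next
  case False
  define P where "P = int (q * m) + 1"
  define D where "D p = {(real_of_int p - \<delta>) / real q<..<(real_of_int p + \<delta>) / real q}" for p
  have D: "measure lborel (D p) = 2 * \<delta> / real q" for p
  proof -
    have "(real_of_int p - \<delta>) / real q \<le> (real_of_int p + \<delta>) / real q"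
      using q d by (intro divide_right_mono) auto
    then show ?thesis by (simp add: D_def diff_divide_distrib[symmetric])
  qed
  have sub: "{- real m..real m} \<inter> {t. near_int \<delta> (real q * t)} \<subseteq> (\<Union>p\<in>{- P..P}. D p)"
  proof
    fix t assume t: "t \<in> {- real m..real m} \<inter> {t. near_int \<delta> (real q * t)}"
    then obtain p :: int where p: "\<bar>real q * t - of_int p\<bar> < \<delta>" by (auto simp: near_int_def)
    have "\<bar>real q * t\<bar> \<le> real q * real m" using t by (simp add: abs_mult abs_le_iff mult_left_mono)
    then have "\<bar>real_of_int p\<bar> \<le> real q * real m + 1" using p False by linarith
    then have "real_of_int \<bar>p\<bar> \<le> real_of_int P" by (simp add: P_def)
    then have "p \<in> {- P..P}" by (simp only: of_int_le_iff) auto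
    moreover have "t \<in> D p"
      using p q unfolding D_def by (auto simp: field_simps abs_less_iff)
    ultimately show "t \<in> (\<Union>p\<in>{- P..P}. D p)" by blast
  qed
  have fm: "(\<Union>p\<in>{- P..P}. D p) \<in> fmeasurable lborel"
  proof (rule fmeasurable.finite_UN)
    show "D p \<in> fmeasurable lborel" for p
      using fmeasurable_box[of "(real_of_int p - \<delta>) / real q" "(real_of_int p + \<delta>) / real q"]
      by (simp only: D_def box_real)
  qed simp
  have "measure lborel ({- real m..real m} \<inter> {t. near_int \<delta> (real q * t)}) \<le> measure lborel (\<Union>p\<in>{- P..P}. D p)"
    by (rule measure_mono_fmeasurable[OF sub _ fm]) (auto simp: open_near_int)
  also have "\<dots> \<le> (\<Sum>p\<in>{- P..P}. measure lborel (D p))"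
    by (rule measure_UNION_le) (auto simp: D_def)
  also have "\<dots> = (2 * real q * real m + 3) * (2 * \<delta> / real q)"
    by (simp add: D P_def algebra_simps)
  also have "\<dots> = (4 * real m + 6 / real q) * \<delta>" using q by (simp add: field_simps)
  also have "\<dots> \<le> (4 * real m + 6) * \<delta>"
    using q d by (intro mult_right_mono) (auto simp: field_simps)
  finally show ?thesis .
qed

text \<open>Borel-Cantelli needs finite measures, so it is applied inside each cube [-m, m]^d with m
  >= 1, and the countably many exceptional null sets are combined.\<close>

theorem AE_not_simul_approximable:
  fixes I :: "'n::finite set"
  assumes I: "I \<noteq> {}" and phi: "\<And>q. 0 \<le> \<phi> q" and sum: "summable (\<lambda>q. \<phi> q ^ card I)"
  shows "AE x :: real ^ 'n in lborel. x \<notin> simul_approximable I \<phi>"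
proof -
  define Q :: "nat \<Rightarrow> (real ^ 'n) set" where "Q m = {x. \<forall>j. x $ j \<in> {- real m..real m}}" for m
  define E :: "nat \<Rightarrow> nat \<Rightarrow> (real ^ 'n) set"
    where "E m q = {x. \<forall>j. x $ j \<in> {- real m..real m} \<inter> (if j \<in> I then {t. near_int (\<phi> q) (real q * t)} else UNIV)}" for m q
  have "AE x :: real ^ 'n in lborel. eventually (\<lambda>q. x \<in> space lborel - E (Suc m) q) sequentially" for m
  proof (rule borel_cantelli_AE1)
    let ?m = "Suc m"
    define J where "J q j = {- real ?m..real ?m} \<inter> (if j \<in> I then {t. near_int (\<phi> q) (real q * t)} else UNIV)" for q j
    have E_J: "E ?m q = {x. \<forall>j. x $ j \<in> J q j}" for q by (simp add: E_def J_def)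
    have Jb: "J q j \<in> sets borel" for q j unfolding J_def by (auto simp: open_near_int)
    show "E ?m q \<in> sets lborel" for q
      unfolding E_J sets_lborel by (rule sets_Collect_vec) (rule Jb)
    have Jfm: "J q j \<in> fmeasurable lborel" for q j
      by (rule fmeasurableI2[of "{- real ?m..real ?m}"]) (use Jb fmeasurable_cbox[of "- real ?m" "real ?m"] in \<open>simp_all add: J_def\<close>)
    have eE: "emeasure lborel (E ?m q) = ennreal (\<Prod>j\<in>UNIV. measure lborel (J q j))" for q
      unfolding E_J using Jb emeasure_eq_measure2[OF Jfm]
      by (intro emeasure_lborel_vec') auto
    show "emeasure lborel (E ?m q) < \<infinity>" for q unfolding eE by simp
    \<comment> \<open>One factor from \<open>measure_near_int_le\<close> for each coordinate in
      \<open>I\<close>, and the full side length for each of the others.\<close>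
    define C where "C = (4 * real ?m + 6) ^ card I * (2 * real ?m) ^ card (- I)"
    show "summable (\<lambda>q. measure lborel (E ?m q))"
    proof (rule summable_comparison_test'[where N = 1])
      show "summable (\<lambda>q. C * \<phi> q ^ card I)" by (rule summable_mult[OF sum])
      fix q :: nat assume q: "q \<ge> 1"
      have "measure lborel (E ?m q) = (\<Prod>j\<in>UNIV. measure lborel (J q j))"
        unfolding measure_def[of lborel "E ?m q"] eE by (simp add: prod_nonneg)
      also have "\<dots> \<le> (\<Prod>j\<in>UNIV. if j \<in> I then (4 * real ?m + 6) * \<phi> q else 2 * real ?m)"
      proof (rule prod_mono)
        fix j
        show "0 \<le> measure lborel (J q j) \<and> measure lborel (J q j) \<le> (if j \<in> I then (4 * real ?m + 6) * \<phi> q else 2 * real ?m)"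
          using measure_near_int_le[OF q, of ?m "\<phi> q"] phi[of q] by (simp add: J_def)
      qed
      also have "\<dots> = ((4 * real ?m + 6) * \<phi> q) ^ card I * (2 * real ?m) ^ card (- I)"
        by (simp add: prod.If_cases Compl_eq)
      also have "\<dots> = C * \<phi> q ^ card I" by (simp only: C_def power_mult_distrib mult_ac)
      finally show "norm (measure lborel (E ?m q)) \<le> C * \<phi> q ^ card I" by simp
    qed
  qed
  then have "AE x :: real ^ 'n in lborel. \<forall>m. eventually (\<lambda>q. x \<in> space lborel - E (Suc m) q) sequentially"
    by (simp only: AE_all_countable) simp
  then show ?thesis
  proof (rule AE_mp, intro AE_I2 impI notI)
    fix x :: "real ^ 'n"
    assume ev: "\<forall>m. eventually (\<lambda>q. x \<in> space lborel - E (Suc m) q) sequentially"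
      and x: "x \<in> simul_approximable I \<phi>"
    obtain m :: nat where m: "norm x \<le> real m" using real_arch_simple by blast
    have "\<bar>x $ j\<bar> \<le> real (Suc m)" for j
      using component_le_norm_cart[of x j] m by simp
    then have xj: "x $ j \<in> {- real (Suc m)..real (Suc m)}" for j
      by (simp only: atLeastAtMost_iff abs_le_iff) (meson minus_le_iff)
    have "frequently (\<lambda>q. q \<ge> 1 \<and> (\<forall>j\<in>I. near_int (\<phi> q) (real q * x $ j))) sequentially"
      using x by (simp add: simul_approximable_def cofinite_eq_sequentially)
    then have "frequently (\<lambda>q. x \<in> E (Suc m) q) sequentially"
      by (rule frequently_elim1) (use xj in \<open>simp add: E_def\<close>)
    moreover have "eventually (\<lambda>q. x \<notin> E (Suc m) q) sequentially"
      using spec[OF ev, of m] by (rule eventually_mono) simp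
    ultimately show False by (simp add: frequently_def)
  qed
qed

section \<open>From the hyperplane to the remaining coordinates\<close>

lemma infnorm_less_iff_cart:
  fixes x :: "real ^ 'n::finite"
  shows "infnorm x < \<delta> \<longleftrightarrow> (\<forall>j. \<bar>x $ j\<bar> < \<delta>)"
proof -
  have "(\<lambda>i. \<bar>x \<bullet> i\<bar>) ` (Basis :: (real ^ 'n) set) = range (\<lambda>j. \<bar>x $ j\<bar>)"
    by (auto simp: Basis_vec_def inner_axis image_iff)
  then show ?thesis by (simp add: infnorm_Max)
qed

text \<open>A fixed q admits only finitely many p within \<psi>(q) of q x, so infinitely many pairs
  (p, q) amount to infinitely many q.\<close>

lemma psi_approximable_iff:
  fixes x :: "real ^ 'n::finite"
  shows "psi_approximable \<psi> x \<longleftrightarrow> x \<in> simul_approximable UNIV \<psi>"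
proof -
  define S where "S = {(p :: int ^ 'n, q :: nat). q \<ge> 1 \<and> (\<forall>j. \<bar>real q * x $ j - real_of_int (p $ j)\<bar> < \<psi> q)}"
  define T where "T = {q. q \<ge> 1 \<and> (\<forall>j\<in>UNIV. near_int (\<psi> q) (real q * x $ j))}"
  have S_T: "snd ` S = T"
  proof (intro set_eqI iffI)
    fix q assume "q \<in> T"
    then have q: "q \<ge> 1" and "\<forall>j. \<exists>p::int. \<bar>real q * x $ j - of_int p\<bar> < \<psi> q"
      by (auto simp: T_def near_int_def)
    then obtain p :: "'n \<Rightarrow> int" where "\<And>j. \<bar>real q * x $ j - of_int (p j)\<bar> < \<psi> q" by metis
    then have "((\<chi> j. p j), q) \<in> S" using q by (simp add: S_def)
    then show "q \<in> snd ` S" by force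
  next
    fix q assume "q \<in> snd ` S"
    then show "q \<in> T" unfolding S_def T_def near_int_def by fastforce
  qed
  have fin: "finite S" if "finite (snd ` S)"
  proof -
    define A where "A q j = {\<lfloor>real q * x $ j - \<psi> q\<rfloor>..\<lceil>real q * x $ j + \<psi> q\<rceil>}" for q j
    have "S \<subseteq> (\<Union>q\<in>snd ` S. (\<lambda>p. (vec_lambda p, q)) ` (PiE UNIV (A q)))"
    proof
      fix z assume z: "z \<in> S"
      obtain p q where pq: "z = (p, q)" by (cases z)
      have "p $ j \<in> A q j" for j
      proof -
        have "\<bar>real q * x $ j - real_of_int (p $ j)\<bar> < \<psi> q" using z by (auto simp: S_def pq)
        then have "real q * x $ j - \<psi> q \<le> real_of_int (p $ j)" "real_of_int (p $ j) \<le> real q * x $ j + \<psi> q"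
          by linarith+
        then show ?thesis unfolding A_def by (simp add: floor_le_iff le_ceiling_iff)
      qed
      then have "($) p \<in> PiE UNIV (A q)" by (intro PiE_I) simp_all
      moreover have "z = (vec_lambda (($) p), q)" by (simp add: pq)
      ultimately show "z \<in> (\<Union>q\<in>snd ` S. (\<lambda>p. (vec_lambda p, q)) ` (PiE UNIV (A q)))"
        using z by (force simp: pq)
    qed
    moreover have "finite (\<Union>q\<in>snd ` S. (\<lambda>p. (vec_lambda p, q)) ` (PiE UNIV (A q)))"
      by (rule finite_UN_I[OF that], intro finite_imageI finite_PiE) (auto simp: A_def)
    ultimately show ?thesis by (rule finite_subset)
  qed
  have "infinite S \<longleftrightarrow> infinite T"
    using fin finite_imageI[of S snd] unfolding S_T by blast
  moreover have "psi_approximable \<psi> x \<longleftrightarrow> infinite S"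
    by (simp add: psi_approximable_def S_def infnorm_less_iff_cart)
  moreover have "x \<in> simul_approximable UNIV \<psi> \<longleftrightarrow> infinite T"
    by (simp add: simul_approximable_def T_def frequently_cofinite)
  ultimately show ?thesis by simp
qed

text \<open>Coordinate i demands that q c be within \<psi>(q) of an integer. Where this fails,
  \<open>restrict_near\<close> has radius 0, and at least one other coordinate is present to reject
  q.\<close>

lemma simul_approximable_hyperplane_iff:
  fixes i :: "'n::finite"
  assumes "CARD('n) \<ge> 2"
  shows "(\<chi> j. if j = i then c else x $ j) \<in> simul_approximable UNIV \<psi>
    \<longleftrightarrow> x \<in> simul_approximable (UNIV - {i}) (restrict_near c \<psi>)"
proof -
  have "UNIV - {i} \<noteq> {}"
  proof
    assume "UNIV - {i} = {}"
    then have "UNIV = {i}" by auto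
    then have "CARD('n) = 1" by (metis card_1_singleton_iff One_nat_def)
    with assms show False by simp
  qed
  then obtain k where k: "k \<noteq> i" by blast
  have "(\<forall>j\<in>UNIV. near_int (\<psi> q) (real q * (\<chi> j. if j = i then c else x $ j) $ j))
      \<longleftrightarrow> (\<forall>j\<in>UNIV - {i}. near_int (restrict_near c \<psi> q) (real q * x $ j))" for q
  proof (cases "near_int (\<psi> q) (real q * c)")
    case True
    then show ?thesis by (auto simp: restrict_near_def)
  next
    case False
    moreover have "\<not> near_int 0 t" for t by (auto simp: near_int_def)
    ultimately show ?thesis using k by (auto simp: restrict_near_def)
  qed
  then show ?thesis by (simp add: simul_approximable_def)
qed


lemma simul_approximable_mono:
  assumes "\<And>q. q \<ge> 1 \<Longrightarrow> \<phi> q \<le> \<psi> q"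
  shows "simul_approximable I \<phi> \<subseteq> simul_approximable I \<psi>"
proof
  fix x assume "x \<in> simul_approximable I \<phi>"
  then have "\<exists>\<^sub>\<infinity>q. q \<ge> 1 \<and> (\<forall>j\<in>I. near_int (\<phi> q) (real q * x $ j))"
    by (simp add: simul_approximable_def)
  then have "\<exists>\<^sub>\<infinity>q. q \<ge> 1 \<and> (\<forall>j\<in>I. near_int (\<psi> q) (real q * x $ j))"
    by (rule frequently_elim1) (use assms near_int_mono in blast)
  then show "x \<in> simul_approximable I \<psi>" by (simp add: simul_approximable_def)
qed

text \<open>If the truncated series converged, its terms would tend to 0, so the truncation would
  eventually be inactive and the two series would agree from there on.\<close>

lemma not_summable_min:
  fixes f :: "nat \<Rightarrow> real"
  assumes f: "\<And>q. f q \<ge> 0" and e: "e > 0" and n: "n \<ge> 1" and div: "\<not> summable (\<lambda>q. f q ^ n)"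
  shows "\<not> summable (\<lambda>q. min (f q) e ^ n)"
proof
  assume sum: "summable (\<lambda>q. min (f q) e ^ n)"
  have "e ^ n > 0" using e by simp
  from order_tendstoD(2)[OF summable_LIMSEQ_zero[OF sum] this]
  have "eventually (\<lambda>q. f q ^ n = min (f q) e ^ n) sequentially"
  proof (rule eventually_mono)
    fix q assume "min (f q) e ^ n < e ^ n"
    then have "min (f q) e \<noteq> e" by auto
    then have "min (f q) e = f q" by (auto simp: min_def split: if_splits)
    then show "f q ^ n = min (f q) e ^ n" by simp
  qed
  then have "summable (\<lambda>q. f q ^ n)" using sum by (simp add: summable_cong)
  with div show False by simp
qed

theorem mainTheorem7:
  fixes i :: "'n::finite" and c :: real
  assumes "CARD('n) \<ge> 2"
    and "c \<notin> \<rat>"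
    and "bounded_ratio c"
  shows "(CARD('n) \<ge> 3 \<longrightarrow> khintchine_type (hyperplane_lborel i c))
    \<and> khintchine_type_convergence (hyperplane_lborel i c)"
proof -
  let ?I = "UNIV - {i}"
  have card: "CARD('n) = Suc (card ?I)" by (simp add: card_Diff_singleton)
  have I: "card ?I \<ge> 1" using assms(1) card by linarith
  then have I_ne: "?I \<noteq> {}" by (metis card.empty not_one_le_zero)
  have psi_set: "{x :: real ^ 'n. psi_approximable \<psi> x} = simul_approximable UNIV \<psi>" for \<psi>
    by (simp add: psi_approximable_iff)
  have conv: "khintchine_type_convergence (hyperplane_lborel i c)"
    unfolding khintchine_type_convergence_def
  proof (intro allI impI, elim conjE)
    fix \<psi> assume psi: "approximating_function \<psi>" and sum: "summable (\<lambda>q. \<psi> (Suc q) ^ CARD('n))"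
    have "summable (\<lambda>q. restrict_near c \<psi> q ^ card ?I)"
      using summable_restrict_near[OF assms(2,3) psi I] sum by (simp only: card)
    then have "AE x :: real ^ 'n in lborel. x \<notin> simul_approximable ?I (restrict_near c \<psi>)"
      by (rule AE_not_simul_approximable[OF I_ne restrict_near_nonneg])
    then have "AE x :: real ^ 'n in lborel. \<not> psi_approximable \<psi> (\<chi> j. if j = i then c else x $ j)"
      by (simp only: psi_approximable_iff simul_approximable_hyperplane_iff[OF assms(1)])
    moreover have "{x :: real ^ 'n. \<not> psi_approximable \<psi> x} \<in> sets borel"
      using borel_comp[OF sets_simul_approximable[of "UNIV :: 'n set" \<psi>]]
      by (simp only: psi_set[symmetric] Collect_neg_eq)
    ultimately show "AE x in hyperplane_lborel i c. \<not> psi_approximable \<psi> x"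
      by (intro AE_hyperplane_lborelI)
  qed
  moreover have "khintchine_type_divergence (hyperplane_lborel i c)" if "CARD('n) \<ge> 3"
    unfolding khintchine_type_divergence_def
  proof (intro allI impI, elim conjE)
    fix \<psi> assume psi: "approximating_function \<psi>" and div: "\<not> summable (\<lambda>q. \<psi> (Suc q) ^ CARD('n))"
    \<comment> \<open>1/24 is the bound asked for by \<open>gallagher\<close>, and it also gives the
      bound 1 in \<open>not_summable_restrict_near\<close>. Shrinking \<psi> only shrinks the set of
      approximable points.\<close>
    define \<psi>' where "\<psi>' q = min (\<psi> q) (1 / 24)" for q
    have psi': "approximating_function \<psi>'"
      using psi unfolding approximating_function_def \<psi>'_def by (auto intro: min.coboundedI1)
    have "\<psi> (Suc q) \<ge> 0" for q using psi by (simp add: approximating_function_def)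
    then have "\<not> summable (\<lambda>q. \<psi>' (Suc q) ^ CARD('n))"
      unfolding \<psi>'_def using div by (intro not_summable_min) auto
    then have "\<not> summable (\<lambda>q. restrict_near c \<psi>' (Suc q) ^ card ?I)"
      unfolding card by (intro not_summable_restrict_near[OF psi' _ I]) (simp_all add: \<psi>'_def min.coboundedI2)
    moreover have "restrict_near c \<psi>' q \<le> 1 / 24" for q
    proof -
      have "\<psi>' q \<le> 1 / 24" unfolding \<psi>'_def by (rule min.cobounded2)
      then show ?thesis unfolding restrict_near_def by (cases "near_int (\<psi>' q) (real q * c)") simp_all
    qed
    moreover have "card ?I \<ge> 2" using that card by linarith
    ultimately have "AE x :: real ^ 'n in lborel. x \<in> simul_approximable ?I (restrict_near c \<psi>')"
      by (intro gallagher restrict_near_nonneg)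
    then have "AE x :: real ^ 'n in lborel. psi_approximable \<psi> (\<chi> j. if j = i then c else x $ j)"
    proof (rule AE_mp, intro AE_I2 impI)
      fix x :: "real ^ 'n" assume "x \<in> simul_approximable ?I (restrict_near c \<psi>')"
      then have "(\<chi> j. if j = i then c else x $ j) \<in> simul_approximable UNIV \<psi>'"
        by (simp only: simul_approximable_hyperplane_iff[OF assms(1)])
      moreover have "simul_approximable UNIV \<psi>' \<subseteq> (simul_approximable UNIV \<psi> :: (real ^ 'n) set)"
        by (rule simul_approximable_mono) (simp add: \<psi>'_def)
      ultimately show "psi_approximable \<psi> (\<chi> j. if j = i then c else x $ j)"
        unfolding psi_approximable_iff by blast
    qed
    moreover have "{x :: real ^ 'n. psi_approximable \<psi> x} \<in> sets borel"
      unfolding psi_set by (rule sets_simul_approximable)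
    ultimately show "AE x in hyperplane_lborel i c. psi_approximable \<psi> x"
      by (intro AE_hyperplane_lborelI)
  qed
  ultimately show ?thesis by (simp add: khintchine_type_def)
qed

end
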